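(* Let $H_0,H_1,H_2$ be polarized representations and let $H_0\stackrel{L_1}{\longrightarrow}H_1\stackrel{L_2}{\longrightarrow}H_2$ be morphisms in the category $\mathcal{PR}$, with composition $L_2\circ L_1$ a morphism from $H_0$ to $H_2$. For splittings $S_0,S_1,S_2$ of $H_0,H_1,H_2$ belonging to the given polarizations, the difference $$\delta(L_1,L_2)=Ind_{S_0,S_1}(L_1)+Ind_{S_1,S_2}(L_2)-Ind_{S_0,S_2}(L_2\circ L_1)$$ does not depend on the particular splittings $S_0,S_1,S_2$.
   Context: Fredholm pairs. Closed subspaces $V,W$ of a Hilbert space form a Fredholm pair if $V+W$ is closed of finite codimension and $\dim(V\cap W)<\infty$; $Ind(V,W)=\dim(V\cap W)-\mathrm{codim}(V+W)$. Splittings and polarizations. A projector is a bounded idempotent. Let $H$ be a Hilbert space (possibly finite dimensional) with a representation of a $C^*$-algebra $B$. A splitting $S$ of $H$ is a direct sum decomposition $H=H^\flat\oplus H^\sharp$ whose projectors $P^\flat$, $P^\sharp$ commute with the action of $B$ up to compact operators; it is encoded by $S=P^\sharp-P^\flat$. Two splittings are equivalent if their projectors coincide up to compact operators; an equivalence class is called a polarization. Category $\mathcal{PR}$. Objects (polarized representations): Hilbert spaces with a representation of some $C^*$-algebra and a distinguished polarization. Morphisms from $H_1$ to $H_2$: closed linear subspaces $L\subset H_1\oplus H_2$ such that $(L,H_1^\flat\oplus H_2^\sharp)$ is a Fredholm pair (for a splitting in the polarizations; the condition does not depend on the choice). Composition of $L_1\subset H_0\oplus H_1$ and $L_2\subset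 H_1\oplus H_2$: $L_2\circ L_1=\{(x,z)\in H_0\oplus H_2:\exists y\in H_1,\ (x,y)\in L_1,\ (y,z)\in L_2\}$. Index of a morphism $L$ from $H_1$ to $H_2$ for splittings $S_1,S_2$: $Ind_{S_1,S_2}(L)=Ind(L,H_1^\flat\oplus H_2^\sharp)$. *)

theory Defs
  imports "HOL-Analysis.Analysis"
begin

section \<open>Complex Hilbert spaces and C*-algebras\<close>

class complex_vector = real_vector +
  fixes scaleC :: "complex \<Rightarrow> 'a \<Rightarrow> 'a" (infixr \<open>*\<^sub>C\<close> 75)
  assumes scaleC_add_right: "c *\<^sub>C (x + y) = c *\<^sub>C x + c *\<^sub>C y"
    and scaleC_add_left: "(c + d) *\<^sub>C x = c *\<^sub>C x + d *\<^sub>C x"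
    and scaleC_scaleC: "c *\<^sub>C (d *\<^sub>C x) = (c * d) *\<^sub>C x"
    and scaleC_one: "1 *\<^sub>C x = x"
    and scaleC_of_real: "complex_of_real r *\<^sub>C x = r *\<^sub>R x"

global_interpretation complex_vector:
  vector_space "scaleC :: complex \<Rightarrow> 'a \<Rightarrow> 'a::complex_vector"
  by unfold_locales (fact scaleC_add_right scaleC_add_left scaleC_scaleC scaleC_one)+

text \<open>
  The complex inner product is linear in its first argument. Its real part is the real inner
  product of \<open>real_inner\<close>, which induces the norm; so definiteness is inherited.
\<close>

class chilbert_space = complex_vector + real_inner + banach +
  fixes cinner :: "'a \<Rightarrow> 'a \<Rightarrow> complex"
  assumes cinner_commute: "cinner x y = cnj (cinner y x)"
    and cinner_add_left: "cinner (x + y) z = cinner x z + cinner y z"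
    and cinner_scaleC_left: "cinner (c *\<^sub>C x) y = c * cinner x y"
    and Re_cinner: "Re (cinner x y) = inner x y"

instantiation prod :: (complex_vector, complex_vector) complex_vector
begin

definition scaleC_prod_def: "c *\<^sub>C p = (c *\<^sub>C fst p, c *\<^sub>C snd p)"

instance
  by standard
    (simp_all add: scaleC_prod_def scaleC_add_right scaleC_add_left scaleC_scaleC scaleC_one
      scaleC_of_real scaleR_prod_def)

end

instantiation prod :: (chilbert_space, chilbert_space) chilbert_space
begin

definition cinner_prod_def: "cinner p q = cinner (fst p) (fst q) + cinner (snd p) (snd q)"

instance
proof
  fix p q r :: "'a \<times> 'b" and c :: complex
  show "cinner p q = cnj (cinner q p)"
    by (simp add: cinner_prod_def cinner_commute[symmetric])
  show "cinner (p + q) r = cinner p r + cinner q r"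
    by (simp add: cinner_prod_def cinner_add_left)
  show "cinner (c *\<^sub>C p) q = c * cinner p q"
    by (simp add: cinner_prod_def scaleC_prod_def cinner_scaleC_left distrib_left)
  show "Re (cinner p q) = inner p q"
    by (simp add: cinner_prod_def inner_prod_def Re_cinner)
qed

end

text \<open>C*-algebras are not assumed to be unital.\<close>

class cstar_algebra = complex_vector + real_normed_algebra + banach +
  fixes star :: "'a \<Rightarrow> 'a"
  assumes mult_scaleC_left: "(c *\<^sub>C a) * b = c *\<^sub>C (a * b)"
    and mult_scaleC_right: "a * (c *\<^sub>C b) = c *\<^sub>C (a * b)"
    and norm_scaleC: "norm (c *\<^sub>C a) = cmod c * norm a"
    and star_star: "star (star a) = a"
    and star_add: "star (a + b) = star a + star b"
    and star_scaleC: "star (c *\<^sub>C a) = cnj c *\<^sub>C star a"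
    and star_mult: "star (a * b) = star b * star a"
    and norm_star_mult: "norm (star a * a) = (norm a)\<^sup>2"

section \<open>Operators\<close>

definition bounded_clinear :: "('a::chilbert_space \<Rightarrow> 'b::chilbert_space) \<Rightarrow> bool" where
  "bounded_clinear T \<longleftrightarrow> bounded_linear T \<and> (\<forall>c x. T (c *\<^sub>C x) = c *\<^sub>C T x)"

definition compact_operator :: "('a::chilbert_space \<Rightarrow> 'b::chilbert_space) \<Rightarrow> bool" where
  "compact_operator T \<longleftrightarrow> bounded_clinear T \<and> compact (closure (T ` ball 0 1))"

definition projector :: "('a::chilbert_space \<Rightarrow> 'a) \<Rightarrow> bool" where
  "projector P \<longleftrightarrow> bounded_clinear P \<and> P \<circ> P = P"

definition representation :: "('b::cstar_algebra \<Rightarrow> 'h::chilbert_space \<Rightarrow> 'h) \<Rightarrow> bool" where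
  "representation \<rho> \<longleftrightarrow>
     (\<forall>a. bounded_clinear (\<rho> a)) \<and>
     (\<forall>a b x. \<rho> (a + b) x = \<rho> a x + \<rho> b x) \<and>
     (\<forall>c a x. \<rho> (c *\<^sub>C a) x = c *\<^sub>C \<rho> a x) \<and>
     (\<forall>a b. \<rho> (a * b) = \<rho> a \<circ> \<rho> b) \<and>
     (\<forall>a x y. cinner (\<rho> (star a) x) y = cinner x (\<rho> a y))"

section \<open>Fredholm pairs\<close>

definition finite_dim :: "'a::complex_vector set \<Rightarrow> bool" where
  "finite_dim V \<longleftrightarrow> (\<exists>B. finite B \<and> V \<subseteq> complex_vector.span B)"

text \<open>
  The vectors in \<open>B\<close> together with \<open>V\<close> span the whole space iff their classes span the
  quotient by \<open>V\<close>. Hence the codimension, i.e. the dimension of the quotient, is the least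
  size of such a \<open>B\<close>. Like \<^const>\<open>complex_vector.dim\<close>, \<open>codim\<close> is only meaningful in the
  finite case.
\<close>

definition finite_codim :: "'a::complex_vector set \<Rightarrow> bool" where
  "finite_codim V \<longleftrightarrow> (\<exists>B. finite B \<and> complex_vector.span (V \<union> B) = UNIV)"

definition codim :: "'a::complex_vector set \<Rightarrow> nat" where
  "codim V = (LEAST n. \<exists>B. finite B \<and> card B = n \<and> complex_vector.span (V \<union> B) = UNIV)"

definition closed_csubspace :: "'a::chilbert_space set \<Rightarrow> bool" where
  "closed_csubspace V \<longleftrightarrow> complex_vector.subspace V \<and> closed V"

definition fredholm_pair :: "'a::chilbert_space set \<Rightarrow> 'a set \<Rightarrow> bool" where
  "fredholm_pair V W \<longleftrightarrow>
     closed_csubspace V \<and> closed_csubspace W \<and>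
     closed (V + W) \<and> finite_codim (V + W) \<and> finite_dim (V \<inter> W)"

definition pair_index :: "'a::chilbert_space set \<Rightarrow> 'a set \<Rightarrow> int" where
  "pair_index V W = int (complex_vector.dim (V \<inter> W)) - int (codim (V + W))"

section \<open>Splittings and polarizations\<close>

text \<open>
  A decomposition into a direct sum is given by its two projectors: two bounded idempotents
  which add up to the identity. The summands are their ranges.
\<close>

record 'h splitting =
  flat_proj :: "'h \<Rightarrow> 'h"
  sharp_proj :: "'h \<Rightarrow> 'h"

definition flat :: "'h splitting \<Rightarrow> 'h set" where
  "flat S = range (flat_proj S)"

definition sharp :: "'h splitting \<Rightarrow> 'h set" where
  "sharp S = range (sharp_proj S)"

definition splittings ::
  "('b::cstar_algebra \<Rightarrow> 'h::chilbert_space \<Rightarrow> 'h) \<Rightarrow> 'h splitting set" where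
  "splittings \<rho> = {S.
     projector (flat_proj S) \<and> projector (sharp_proj S) \<and>
     (\<forall>x. flat_proj S x + sharp_proj S x = x) \<and>
     (\<forall>b. compact_operator (\<lambda>x. \<rho> b (flat_proj S x) - flat_proj S (\<rho> b x))) \<and>
     (\<forall>b. compact_operator (\<lambda>x. \<rho> b (sharp_proj S x) - sharp_proj S (\<rho> b x)))}"

definition splitting_equiv ::
  "('b::cstar_algebra \<Rightarrow> 'h::chilbert_space \<Rightarrow> 'h) \<Rightarrow> ('h splitting \<times> 'h splitting) set" where
  "splitting_equiv \<rho> = {(S, T). S \<in> splittings \<rho> \<and> T \<in> splittings \<rho> \<and>
     compact_operator (\<lambda>x. flat_proj S x - flat_proj T x) \<and>
     compact_operator (\<lambda>x. sharp_proj S x - sharp_proj T x)}"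

section \<open>Polarized representations and their morphisms\<close>

record ('b, 'h) polarized_rep =
  rep :: "'b \<Rightarrow> 'h \<Rightarrow> 'h"
  polarization :: "'h splitting set"

definition polarized_representation ::
  "('b::cstar_algebra, 'h::chilbert_space) polarized_rep \<Rightarrow> bool" where
  "polarized_representation H \<longleftrightarrow>
     representation (rep H) \<and>
     polarization H \<in> splittings (rep H) // splitting_equiv (rep H)"

definition morphism ::
  "('b1::cstar_algebra, 'h1::chilbert_space) polarized_rep \<Rightarrow>
   ('b2::cstar_algebra, 'h2::chilbert_space) polarized_rep \<Rightarrow> ('h1 \<times> 'h2) set \<Rightarrow> bool" where
  "morphism H1 H2 L \<longleftrightarrow>
     closed_csubspace L \<and>
     (\<exists>S1 \<in> polarization H1. \<exists>S2 \<in> polarization H2. fredholm_pair L (flat S1 \<times> sharp S2))"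

definition morphism_index ::
  "'h1::chilbert_space splitting \<Rightarrow> 'h2::chilbert_space splitting \<Rightarrow> ('h1 \<times> 'h2) set \<Rightarrow> int" where
  "morphism_index S1 S2 L = pair_index L (flat S1 \<times> sharp S2)"

definition composition :: "('h1 \<times> 'h2) set \<Rightarrow> ('h0 \<times> 'h1) set \<Rightarrow> ('h0 \<times> 'h2) set" where
  "composition L2 L1 = {(x, z). \<exists>y. (x, y) \<in> L1 \<and> (y, z) \<in> L2}"

definition index_defect ::
  "'h0::chilbert_space splitting \<Rightarrow> 'h1::chilbert_space splitting \<Rightarrow> 'h2::chilbert_space splitting \<Rightarrow>
   ('h0 \<times> 'h1) set \<Rightarrow> ('h1 \<times> 'h2) set \<Rightarrow> int" where
  "index_defect S0 S1 S2 L1 L2 =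
     morphism_index S0 S1 L1 + morphism_index S1 S2 L2 - morphism_index S0 S2 (composition L2 L1)"

end

theory Submission
  imports Defs
begin

text \<open>
  The index of a pair \<open>(V, W)\<close> is the Fredholm index of the addition map
  \<open>V \<times> W \<rightarrow> H\<close>: its kernel is a copy of \<open>V \<inter> W\<close> and its range is \<open>V + W\<close>. Replacing the
  splittings \<open>T\<^sub>1, T\<^sub>2\<close> by equivalent ones \<open>S\<^sub>1, S\<^sub>2\<close> replaces the second factor
  \<open>W\<^sub>T = T\<^sub>1\<^sup>\<flat> \<times> T\<^sub>2\<^sup>\<sharp>\<close> by \<open>W\<^sub>S = S\<^sub>1\<^sup>\<flat> \<times> S\<^sub>2\<^sup>\<sharp>\<close>. The projectors of the \<open>S\<close> map \<open>W\<^sub>T\<close> to \<open>W\<^sub>S\<close>,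
  and the composite \<open>L \<times> W\<^sub>T \<rightarrow> L \<times> W\<^sub>S \<rightarrow> H\<close> differs from addition on \<open>L \<times> W\<^sub>T\<close> by a compact
  operator. A compact perturbation does not change the index, and the index is additive under
  composition, so the two indices of \<open>L\<close> differ by the index of the flat projector
  \<open>T\<^sub>1\<^sup>\<flat> \<rightarrow> S\<^sub>1\<^sup>\<flat>\<close> plus the index of the sharp projector \<open>T\<^sub>2\<^sup>\<sharp> \<rightarrow> S\<^sub>2\<^sup>\<sharp>\<close>.

  For two equivalent splittings of one space the flat and the sharp index are opposite, because
  together the two projectors form a compact perturbation of the isomorphism \<open>T\<^sup>\<flat> \<oplus> T\<^sup>\<sharp> = H\<close>.
  Hence, with \<open>d\<^sub>i\<close> the flat index in \<open>H\<^sub>i\<close>, a change of splittings changes the index of a morphism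
  from \<open>H\<^sub>i\<close> to \<open>H\<^sub>j\<close> by \<open>d\<^sub>i - d\<^sub>j\<close> (\<open>morphism_index_difference\<close>). In the difference
  of the theorem these contributions cancel: \<open>(d\<^sub>0 - d\<^sub>1) + (d\<^sub>1 - d\<^sub>2) - (d\<^sub>0 - d\<^sub>2) = 0\<close>.

  The index theory needed for this has an algebraic half, additivity (\<open>index_compose\<close>) and
  invariance under changes on a quotient of finite dimension (\<open>index_change_finite_codim\<close>), and
  an analytic half, stability under small perturbations (\<open>index_small_perturbation\<close>), which
  rests on the bounded inverse theorem. A compact operator on a Hilbert space is the sum of a small
  one and one of finite rank, so the two halves give \<open>index_compact_perturbation\<close>.
\<close>

section \<open>Complex linear maps\<close>


abbreviation clinear :: "('a::complex_vector \<Rightarrow> 'b::complex_vector) \<Rightarrow> bool" where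
  "clinear \<equiv> Vector_Spaces.linear scaleC scaleC"

abbreviation csubspace :: "'a::complex_vector set \<Rightarrow> bool" where
  "csubspace \<equiv> complex_vector.subspace"

lemma complex_vector_pair:
  "vector_space_pair (scaleC :: complex \<Rightarrow> 'a::complex_vector \<Rightarrow> 'a)
     (scaleC :: complex \<Rightarrow> 'b::complex_vector \<Rightarrow> 'b)"
  by unfold_locales

lemma clinear_iff:
  "clinear f \<longleftrightarrow> (\<forall>x y. f (x + y) = f x + f y) \<and> (\<forall>c x. f (c *\<^sub>C x) = c *\<^sub>C f x)"
proof
  assume "clinear f"
  then interpret Vector_Spaces.linear scaleC scaleC f .
  show "(\<forall>x y. f (x + y) = f x + f y) \<and> (\<forall>c x. f (c *\<^sub>C x) = c *\<^sub>C f x)"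
    by (simp add: add scale)
next
  assume "(\<forall>x y. f (x + y) = f x + f y) \<and> (\<forall>c x. f (c *\<^sub>C x) = c *\<^sub>C f x)"
  then show "clinear f"
    by unfold_locales auto
qed

lemma clinearI:
  assumes "\<And>x y. f (x + y) = f x + f y" and "\<And>c x. f (c *\<^sub>C x) = c *\<^sub>C f x"
  shows "clinear f"
  using assms by (simp add: clinear_iff)

lemma
  assumes "clinear f"
  shows clinear_add: "f (x + y) = f x + f y"
    and clinear_scaleC: "f (c *\<^sub>C x) = c *\<^sub>C f x"
    and clinear_0: "f 0 = 0"
    and clinear_diff: "f (x - y) = f x - f y"
proof -
  interpret Vector_Spaces.linear scaleC scaleC f by fact
  show "f (x + y) = f x + f y" "f (c *\<^sub>C x) = c *\<^sub>C f x" "f 0 = 0" "f (x - y) = f x - f y"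
    by (auto simp: add scale diff)
qed

lemma csubspace_image: "clinear f \<Longrightarrow> csubspace V \<Longrightarrow> csubspace (f ` V)"
  by (rule module_hom.subspace_image) (simp add: module_hom_iff_linear)

lemma csubspace_kernel: "clinear f \<Longrightarrow> csubspace V \<Longrightarrow> csubspace {x \<in> V. f x = 0}"
  by (rule complex_vector.subspaceI)
    (auto simp: clinear_add clinear_scaleC clinear_0 complex_vector.subspace_0
      complex_vector.subspace_add complex_vector.subspace_scale)

lemma csubspace_vimage: "clinear f \<Longrightarrow> csubspace V \<Longrightarrow> csubspace W \<Longrightarrow> csubspace {x \<in> V. f x \<in> W}"
  by (rule complex_vector.subspaceI)
    (auto simp: clinear_add clinear_scaleC clinear_0 complex_vector.subspace_0
      complex_vector.subspace_add complex_vector.subspace_scale)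

lemma clinear_span_image: "clinear f \<Longrightarrow> complex_vector.span (f ` V) = f ` complex_vector.span V"
  by (rule module_hom.span_image) (simp add: module_hom_iff_linear)

lemma clinear_compose: "clinear f \<Longrightarrow> clinear g \<Longrightarrow> clinear (\<lambda>x. g (f x))"
  by (simp add: clinear_iff)

lemma clinear_ident: "clinear (\<lambda>x. x)"
  by (simp add: clinear_iff)

lemma clinear_inj_on_iff:
  assumes "clinear f" "csubspace V"
  shows "inj_on f V \<longleftrightarrow> (\<forall>x\<in>V. f x = 0 \<longrightarrow> x = 0)"
  using module_hom.inj_on_iff_eq_0[of scaleC scaleC f V] assms by (simp add: module_hom_iff_linear)

lemma clinear_left_inverse:
  assumes "clinear f" "csubspace V" "inj_on f V"
  shows "\<exists>g. range g \<subseteq> V \<and> clinear g \<and> (\<forall>x\<in>V. g (f x) = x)"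
  using vector_space_pair.linear_exists_left_inverse_on[OF complex_vector_pair, of f V] assms by simp

section \<open>Dimension\<close>

lemma finite_dim_subset: "finite_dim V \<Longrightarrow> U \<subseteq> V \<Longrightarrow> finite_dim U"
  unfolding finite_dim_def by blast

lemma finite_dim_image:
  assumes "clinear f" "finite_dim V" shows "finite_dim (f ` V)"
proof -
  obtain B where "finite B" "V \<subseteq> complex_vector.span B"
    using assms(2) by (auto simp: finite_dim_def)
  then show ?thesis
    unfolding finite_dim_def
    by (intro exI[of _ "f ` B"]) (auto simp: clinear_span_image[OF assms(1)])
qed

lemma finite_dim_basis:
  assumes "finite_dim V" "csubspace V"
  obtains B where "finite B" "B \<subseteq> V" "complex_vector.independent B"
    "complex_vector.span B = V" "card B = complex_vector.dim V"
proof -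
  obtain B where B: "B \<subseteq> V" "complex_vector.independent B" "V \<subseteq> complex_vector.span B"
    "card B = complex_vector.dim V"
    by (rule complex_vector.basis_exists)
  obtain C where "finite C" "V \<subseteq> complex_vector.span C"
    using assms(1) by (auto simp: finite_dim_def)
  then have "finite B"
    using complex_vector.independent_span_bound[of C B] B by blast
  with B assms(2) that show ?thesis
    by (metis complex_vector.span_subspace)
qed

text \<open>
  A basis of the kernel is extended to a basis of \<open>V\<close>; the new vectors map injectively onto a
  basis of the image. The ambient space may have infinite dimension, so finiteness is part of the claim.
\<close>

lemma rank_nullity:
  assumes f: "clinear f" and V: "csubspace V"
  shows "finite_dim V \<longleftrightarrow> finite_dim {x \<in> V. f x = 0} \<and> finite_dim (f ` V)"
    and "finite_dim V \<Longrightarrow>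
      complex_vector.dim V = complex_vector.dim {x \<in> V. f x = 0} + complex_vector.dim (f ` V)"
proof -
  let ?K = "{x \<in> V. f x = 0}"
  obtain A where A: "A \<subseteq> ?K" "complex_vector.independent A" "?K \<subseteq> complex_vector.span A"
    "card A = complex_vector.dim ?K"
    by (rule complex_vector.basis_exists)
  obtain B where B: "A \<subseteq> B" "B \<subseteq> V" "complex_vector.independent B" "V \<subseteq> complex_vector.span B"
    using complex_vector.maximal_independent_subset_extend[of A V] A by auto
  have cardB: "card B = complex_vector.dim V"
    using B by (intro complex_vector.basis_card_eq_dim)
  have spB: "complex_vector.span B = V"
    using B V by (metis complex_vector.span_subspace)
  have spA: "complex_vector.span A = ?K"
    using A csubspace_kernel[OF f V] by (metis complex_vector.span_subspace)
  let ?C = "B - A"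
  have indC: "complex_vector.independent ?C"
    using B(3) by (rule complex_vector.independent_mono) auto
  have inj: "inj_on f (complex_vector.span ?C)"
    unfolding clinear_inj_on_iff[OF f complex_vector.subspace_span]
  proof (intro ballI impI)
    fix x assume x: "x \<in> complex_vector.span ?C" "f x = 0"
    then have "x \<in> V"
      using complex_vector.span_mono[of ?C B] spB by blast
    with x have "x \<in> complex_vector.span A" using spA by simp
    \<comment> \<open>The coordinates of \<open>x\<close> in the basis \<open>B\<close> are supported in \<open>A\<close> and in \<open>B - A\<close>.\<close>
    show "x = 0"
    proof -
      have "complex_vector.representation B x = complex_vector.representation ?C x"
        using complex_vector.representation_extend[OF B(3) x(1)] by auto
      moreover have "complex_vector.representation B x = complex_vector.representation A x"
        using complex_vector.representation_extend[OF B(3) \<open>x \<in> complex_vector.span A\<close>] B(1) by auto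
      ultimately have "complex_vector.representation ?C x b = 0" for b
        by (metis DiffD2 complex_vector.representation_ne_zero)
      then show "x = 0"
        using complex_vector.sum_nonzero_representation_eq[OF indC x(1)] by simp
    qed
  qed
  have im: "f ` V = complex_vector.span (f ` ?C)"
  proof
    show "f ` V \<subseteq> complex_vector.span (f ` ?C)"
    proof (rule image_subsetI)
      fix x assume "x \<in> V"
      then have "f x \<in> complex_vector.span (f ` B)"
        using spB by (simp add: clinear_span_image[OF f])
      also have "f ` B \<subseteq> complex_vector.span (f ` ?C)"
      proof (rule image_subsetI)
        fix b assume b: "b \<in> B"
        show "f b \<in> complex_vector.span (f ` ?C)"
        proof (cases "b \<in> A")
          case True
          with A(1) show ?thesis by (auto simp: complex_vector.span_zero)
        next
          case False
          with b show ?thesis by (simp add: complex_vector.span_base)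
        qed
      qed
      then have "complex_vector.span (f ` B) \<subseteq> complex_vector.span (f ` ?C)"
        by (simp add: complex_vector.span_minimal)
      finally show "f x \<in> complex_vector.span (f ` ?C)" .
    qed
    have "f ` ?C \<subseteq> f ` V" using B(2) by auto
    then show "complex_vector.span (f ` ?C) \<subseteq> f ` V"
      by (rule complex_vector.span_minimal) (rule csubspace_image[OF f V])
  qed
  have indf: "complex_vector.independent (f ` ?C)"
    using module_hom.independent_injective_image[of scaleC scaleC f ?C] f indC inj
    by (simp add: module_hom_iff_linear)
  have injC: "inj_on f ?C"
    using inj by (rule inj_on_subset) (simp add: complex_vector.span_superset)
  have dimf: "complex_vector.dim (f ` V) = card ?C"
    unfolding im complex_vector.dim_span complex_vector.dim_eq_card_independent[OF indf]
    by (rule card_image[OF injC])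
  have finI: "finite D" if "complex_vector.independent D" "D \<subseteq> W" "finite_dim W" for D and W :: "'c::complex_vector set"
    using that complex_vector.independent_span_bound unfolding finite_dim_def by blast
  show *: "finite_dim V \<longleftrightarrow> finite_dim ?K \<and> finite_dim (f ` V)"
  proof
    assume "finite_dim V"
    then show "finite_dim ?K \<and> finite_dim (f ` V)"
      using finite_dim_image[OF f] finite_dim_subset[of V ?K] by auto
  next
    assume h: "finite_dim ?K \<and> finite_dim (f ` V)"
    have "finite A" using finI[of A ?K] A h by blast
    moreover have "f ` ?C \<subseteq> f ` V" using B(2) by auto
    then have "finite (f ` ?C)" using finI[of "f ` ?C" "f ` V"] h indf by blast
    then have "finite ?C" using injC by (simp add: finite_image_iff)
    ultimately have "finite B" by simp
    with B show "finite_dim V" by (auto simp: finite_dim_def)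
  qed
  assume "finite_dim V"
  then have "finite B" using finI[of B V] B by blast
  then have "card B = card A + card ?C"
    using B(1) by (metis card_Diff_subset card_mono finite_subset le_add_diff_inverse)
  then show "complex_vector.dim V = complex_vector.dim ?K + complex_vector.dim (f ` V)"
    using cardB A(4) dimf by simp
qed

lemma finite_dim_zero: "finite_dim {0}"
  unfolding finite_dim_def by (intro exI[of _ "{}"]) simp

lemma dim_zero: "complex_vector.dim {0::'a::complex_vector} = 0"
  using complex_vector.dim_le_card[of "{0::'a}" "{}"] by simp

lemma dim_inj_image:
  assumes f: "clinear f" and V: "csubspace V" and inj: "inj_on f V"
  shows "finite_dim (f ` V) \<longleftrightarrow> finite_dim V" and "complex_vector.dim (f ` V) = complex_vector.dim V"
proof -
  have K: "{x \<in> V. f x = 0} = {0}"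
    using inj V by (auto simp: clinear_inj_on_iff[OF f V] complex_vector.subspace_0 clinear_0[OF f])
  show "finite_dim (f ` V) \<longleftrightarrow> finite_dim V"
    using rank_nullity(1)[OF f V] by (simp add: K finite_dim_zero)
  obtain B where B: "B \<subseteq> V" "complex_vector.independent B" "V \<subseteq> complex_vector.span B"
    "card B = complex_vector.dim V"
    by (rule complex_vector.basis_exists)
  have sp: "complex_vector.span B = V"
    using B V by (metis complex_vector.span_subspace)
  have "complex_vector.independent (f ` B)"
    using module_hom.independent_injective_image[of scaleC scaleC f B] f B(2) inj
    by (simp add: module_hom_iff_linear sp)
  then have "complex_vector.dim (f ` V) = card (f ` B)"
    by (metis clinear_span_image[OF f] complex_vector.dim_span_eq_card_independent sp)
  also have "\<dots> = complex_vector.dim V"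
    using card_image[of f B] inj B by (simp add: inj_on_subset)
  finally show "complex_vector.dim (f ` V) = complex_vector.dim V" .
qed

section \<open>Quotients\<close>

lemma quotient_projector_exists:
  assumes "csubspace U"
  shows "\<exists>q. clinear q \<and> (\<forall>x. q (q x) = q x) \<and> (\<forall>x. q x = 0 \<longleftrightarrow> x \<in> U)"
proof -
  obtain g where g: "range g \<subseteq> U" "clinear g" "\<forall>x\<in>U. g x = x"
    using clinear_left_inverse[OF clinear_ident assms] by auto
  have *: "g (g x) = g x" for x using g by blast
  have "clinear (\<lambda>x. x - g x)"
    by (rule clinearI)
      (simp_all add: clinear_add[OF g(2)] clinear_scaleC[OF g(2)] complex_vector.scale_right_diff_distrib)
  moreover have "x - g x = 0 \<longleftrightarrow> x \<in> U" for x
  proof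
    assume "x - g x = 0"
    then have "x = g x" by simp
    then show "x \<in> U" using g(1) by (metis rangeI subsetD)
  qed (use g in auto)
  ultimately show ?thesis
    by (intro exI[of _ "\<lambda>x. x - g x"]) (auto simp: clinear_diff[OF g(2)] *)
qed

text \<open>
  The quotient of the ambient space by \<open>U\<close> is realised inside that space, as a complement of \<open>U\<close>:
  \<open>quotient_map U\<close> is a linear projector onto some complement, and the quotient \<open>V / U\<close> becomes the
  image of \<open>V\<close>. No continuity is asked for, so the complement exists for every subspace.
\<close>

definition quotient_map :: "'a::complex_vector set \<Rightarrow> 'a \<Rightarrow> 'a" where
  "quotient_map U =
     (SOME q. clinear q \<and> (\<forall>x. q (q x) = q x) \<and> (\<forall>x. q x = 0 \<longleftrightarrow> x \<in> U))"

lemma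
  assumes "csubspace U"
  shows clinear_quotient_map: "clinear (quotient_map U)"
    and quotient_map_idem: "quotient_map U (quotient_map U x) = quotient_map U x"
    and quotient_map_eq_0_iff: "quotient_map U x = 0 \<longleftrightarrow> x \<in> U"
  using someI_ex[OF quotient_projector_exists[OF assms]] by (simp_all add: quotient_map_def)

definition finite_quotient :: "'a::complex_vector set \<Rightarrow> 'a set \<Rightarrow> bool" where
  "finite_quotient U V \<longleftrightarrow> finite_dim (quotient_map U ` V)"

definition quotient_dim :: "'a::complex_vector set \<Rightarrow> 'a set \<Rightarrow> nat" where
  "quotient_dim U V = complex_vector.dim (quotient_map U ` V)"

text \<open>
  The first isomorphism theorem. It makes the dimension of \<open>V / U\<close> computable from any linear map
  with kernel \<open>U\<close> on \<open>V\<close>, whichever complement \<open>quotient_map\<close> has chosen.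
\<close>

lemma quotient_by_kernel:
  assumes f: "clinear f" and V: "csubspace V" and U: "csubspace U"
    and ker: "\<And>x. x \<in> V \<Longrightarrow> f x = 0 \<longleftrightarrow> x \<in> U" and UV: "U \<subseteq> V"
  shows "finite_quotient U V \<longleftrightarrow> finite_dim (f ` V)"
    and "quotient_dim U V = complex_vector.dim (f ` V)"
proof -
  let ?q = "quotient_map U"
  note q = clinear_quotient_map[OF U] quotient_map_idem[OF U] quotient_map_eq_0_iff[OF U]
  have d: "x - ?q x \<in> U" for x
    by (simp add: q(3)[symmetric] clinear_diff[OF q(1)] q(2))
  have qV: "?q x \<in> V" if "x \<in> V" for x
    using complex_vector.subspace_diff[OF V that, of "x - ?q x"] d[of x] UV by auto
  have fq: "f (?q x) = f x" if "x \<in> V" for x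
    using ker[of "x - ?q x"] d[of x] UV by (auto simp: clinear_diff[OF f])
  have sub: "csubspace (?q ` V)" using csubspace_image[OF q(1) V] .
  have im: "f ` V = f ` ?q ` V" using fq by (simp add: image_image)
  have "inj_on f (?q ` V)"
    unfolding clinear_inj_on_iff[OF f sub]
  proof (intro ballI impI)
    fix y assume "y \<in> ?q ` V" "f y = 0"
    then obtain x where "x \<in> V" "y = ?q x" "f x = 0" using fq by auto
    then show "y = 0" using ker q(3) by blast
  qed
  from dim_inj_image[OF f sub this]
  show "finite_quotient U V \<longleftrightarrow> finite_dim (f ` V)"
    and "quotient_dim U V = complex_vector.dim (f ` V)"
    by (simp_all add: im finite_quotient_def quotient_dim_def)
qed

lemma quotient_tower:
  assumes U: "csubspace U" and V: "csubspace V" and W: "csubspace W" and UV: "U \<subseteq> V" and VW: "V \<subseteq> W"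
  shows "finite_quotient U W \<longleftrightarrow> finite_quotient U V \<and> finite_quotient V W"
    and "finite_quotient U W \<Longrightarrow> quotient_dim U W = quotient_dim U V + quotient_dim V W"
proof -
  let ?q = "quotient_map U"
  note q = clinear_quotient_map[OF U] quotient_map_eq_0_iff[OF U]
  let ?X = "?q ` W" and ?Y = "?q ` V"
  have X: "csubspace ?X" and Y: "csubspace ?Y"
    using csubspace_image[OF q(1)] V W by auto
  let ?r = "quotient_map ?Y"
  note r = clinear_quotient_map[OF Y] quotient_map_eq_0_iff[OF Y]
  have ker: "{x \<in> ?X. ?r x = 0} = ?Y"
    using VW by (auto simp: r(2))
  have qV: "?q x \<in> ?Y \<longleftrightarrow> x \<in> V" for x
  proof
    assume "?q x \<in> ?Y"
    then obtain v where v: "v \<in> V" "?q x = ?q v" by auto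
    then have "x - v \<in> U" by (simp add: q(2)[symmetric] clinear_diff[OF q(1)])
    then show "x \<in> V"
      using complex_vector.subspace_add[OF V, of "x - v" v] UV v by auto
  qed auto
  have VW': "finite_quotient V W \<longleftrightarrow> finite_dim (?r ` ?X)"
    "quotient_dim V W = complex_vector.dim (?r ` ?X)"
    using quotient_by_kernel[OF clinear_compose[OF q(1) r(1)] W V _ VW] by (auto simp: r(2) qV image_image)
  show "finite_quotient U W \<longleftrightarrow> finite_quotient U V \<and> finite_quotient V W"
    using rank_nullity(1)[OF r(1) X] unfolding ker VW' by (simp add: finite_quotient_def)
  show "quotient_dim U W = quotient_dim U V + quotient_dim V W" if "finite_quotient U W"
    using rank_nullity(2)[OF r(1) X] that unfolding ker VW' by (simp add: finite_quotient_def quotient_dim_def)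
qed

text \<open>
  A set that spans the whole space together with \<open>V\<close> has an image that spans the quotient, so it
  has at least as many elements as the quotient has dimensions; a basis of the chosen complement
  attains the bound.
\<close>

lemma codim_eq_quotient_dim:
  assumes V: "csubspace V" and fin: "finite_codim V"
  shows "finite_quotient V UNIV" and "codim V = quotient_dim V UNIV"
proof -
  let ?q = "quotient_map V"
  note q = clinear_quotient_map[OF V] quotient_map_idem[OF V] quotient_map_eq_0_iff[OF V]
  have sp: "range ?q \<subseteq> complex_vector.span (?q ` B)" if "complex_vector.span (V \<union> B) = UNIV" for B
  proof -
    have "range ?q = complex_vector.span (?q ` (V \<union> B))"
      by (simp only: clinear_span_image[OF q(1)] that)
    also have "?q ` (V \<union> B) \<subseteq> complex_vector.span (?q ` B)"
      by (auto simp: q(3)[THEN iffD2] complex_vector.span_zero complex_vector.span_base)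
    then have "complex_vector.span (?q ` (V \<union> B)) \<subseteq> complex_vector.span (?q ` B)"
      by (simp add: complex_vector.span_minimal)
    finally show ?thesis .
  qed
  obtain B0 where "finite B0" "complex_vector.span (V \<union> B0) = UNIV"
    using fin by (auto simp: finite_codim_def)
  then show fq: "finite_quotient V UNIV"
    using sp[of B0] unfolding finite_quotient_def finite_dim_def by blast
  have "csubspace (range ?q)" using csubspace_image[OF q(1), of UNIV] by simp
  then obtain B where B: "finite B" "complex_vector.span B = range ?q"
    "card B = complex_vector.dim (range ?q)"
    using finite_dim_basis fq[unfolded finite_quotient_def] by metis
  have univ: "complex_vector.span (V \<union> B) = UNIV"
  proof -
    have "x \<in> complex_vector.span (V \<union> B)" for x
    proof -
      have "x - ?q x \<in> V" by (simp add: q(3)[symmetric] clinear_diff[OF q(1)] q(2))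
      then have "x - ?q x \<in> complex_vector.span (V \<union> B)" by (simp add: complex_vector.span_base)
      moreover have "?q x \<in> complex_vector.span B" using B by auto
      then have "?q x \<in> complex_vector.span (V \<union> B)"
        using complex_vector.span_mono[of B "V \<union> B"] by auto
      ultimately have "(x - ?q x) + ?q x \<in> complex_vector.span (V \<union> B)"
        by (rule complex_vector.span_add)
      then show ?thesis by simp
    qed
    then show ?thesis by auto
  qed
  show "codim V = quotient_dim V UNIV"
    unfolding codim_def quotient_dim_def
  proof (rule Least_equality)
    show "\<exists>B. finite B \<and> card B = complex_vector.dim (range ?q) \<and> complex_vector.span (V \<union> B) = UNIV"
      using B univ by blast
    fix n assume "\<exists>B. finite B \<and> card B = n \<and> complex_vector.span (V \<union> B) = UNIV"
    then obtain C where C: "finite C" "card C = n" "complex_vector.span (V \<union> C) = UNIV" by blast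
    have "complex_vector.dim (range ?q) \<le> card (?q ` C)"
      using sp[OF C(3)] C(1) by (intro complex_vector.dim_le_card) auto
    also have "\<dots> \<le> n" using card_image_le[OF C(1)] C(2) by auto
    finally show "complex_vector.dim (range ?q) \<le> n" .
  qed
qed



section \<open>Fredholm maps between subspaces\<close>

text \<open>
  The maps are total functions on the ambient types and the subspaces are separate arguments: the
  domains that occur depend on the splittings, so they cannot be types. The notion is purely
  algebraic. For bounded maps between closed subspaces it is the usual one.
\<close>

definition fredholm :: "('a::complex_vector \<Rightarrow> 'b::complex_vector) \<Rightarrow> 'a set \<Rightarrow> 'b set \<Rightarrow> bool" where
  "fredholm f A B \<longleftrightarrow> clinear f \<and> csubspace A \<and> csubspace B \<and> f ` A \<subseteq> B \<and>
     finite_dim {x \<in> A. f x = 0} \<and> finite_quotient (f ` A) B"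

definition index :: "('a::complex_vector \<Rightarrow> 'b::complex_vector) \<Rightarrow> 'a set \<Rightarrow> 'b set \<Rightarrow> int" where
  "index f A B = int (complex_vector.dim {x \<in> A. f x = 0}) - int (quotient_dim (f ` A) B)"

lemma
  assumes "clinear f" "clinear g" "\<And>x. x \<in> A \<Longrightarrow> f x = g x"
  shows fredholm_cong: "fredholm f A B \<longleftrightarrow> fredholm g A B"
    and index_cong: "index f A B = index g A B"
proof -
  have "{x \<in> A. f x = 0} = {x \<in> A. g x = 0}" "f ` A = g ` A"
    using assms(3) by auto
  then show "fredholm f A B \<longleftrightarrow> fredholm g A B" "index f A B = index g A B"
    using assms(1,2) by (simp_all add: fredholm_def index_def)
qed

lemma quotient_self:
  assumes "csubspace U" shows "finite_quotient U U" and "quotient_dim U U = 0"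
proof -
  have "quotient_map U ` U = {0}"
    using complex_vector.subspace_0[OF assms] by (auto simp: quotient_map_eq_0_iff[OF assms] image_iff)
  then show "finite_quotient U U" and "quotient_dim U U = 0"
    by (simp_all add: finite_quotient_def quotient_dim_def finite_dim_zero dim_zero)
qed

lemma bijective_fredholm:
  assumes f: "clinear f" and A: "csubspace A" and "inj_on f A" "f ` A = B"
  shows "fredholm f A B" and "index f A B = 0"
proof -
  have "{x \<in> A. f x = 0} = {0}"
    using assms by (auto simp: clinear_inj_on_iff complex_vector.subspace_0 clinear_0)
  then show "fredholm f A B" and "index f A B = 0"
    using assms csubspace_image[OF f A] quotient_self[of B]
    by (auto simp: fredholm_def index_def finite_dim_zero dim_zero)
qed

text \<open>
  With \<open>I = ker g \<inter> f A\<close> and \<open>D = f A + ker g\<close>, rank-nullity for \<open>f\<close> on \<open>ker (g f)\<close> gives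
  \<open>dim ker (g f) = dim ker f + dim I\<close>, and for the quotient map on \<open>ker g\<close> it gives
  \<open>dim ker g = dim I + dim (D / f A)\<close>. As \<open>g\<close> induces \<open>B / D \<cong> g B / g f A\<close>, the cokernels are
  counted by the towers \<open>f A \<subseteq> D \<subseteq> B\<close> and \<open>g f A \<subseteq> g B \<subseteq> C\<close>. The same four
  relations between dimensions show which spaces are finite.
\<close>

lemma fredholm_compose_lemma:
  assumes f: "clinear f" and g: "clinear g"
    and A: "csubspace A" and B: "csubspace B" and C: "csubspace C"
    and fA: "f ` A \<subseteq> B" and gB: "g ` B \<subseteq> C"
  shows "fredholm f A B \<Longrightarrow> fredholm g B C \<longleftrightarrow> fredholm (\<lambda>x. g (f x)) A C"
    and "fredholm f A B \<Longrightarrow> fredholm g B C \<Longrightarrow> index (\<lambda>x. g (f x)) A C = index f A B + index g B C"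
proof -
  define N where "N = {x \<in> A. g (f x) = 0}"
  define Kf where "Kf = {x \<in> A. f x = 0}"
  define Kg where "Kg = {y \<in> B. g y = 0}"
  define D where "D = {y \<in> B. g y \<in> g ` f ` A}"
  let ?h = "\<lambda>x. g (f x)"
  note h = clinear_compose[OF f g]
  have sub: "csubspace N" "csubspace Kf" "csubspace Kg" "csubspace (f ` A)" "csubspace (g ` B)"
    "csubspace (g ` f ` A)" "csubspace (?h ` A)" "csubspace D"
    using csubspace_kernel[OF h A] csubspace_kernel[OF f A] csubspace_kernel[OF g B]
      csubspace_image[OF f A] csubspace_image[OF g B] csubspace_image[OF h A]
      csubspace_image[OF g csubspace_image[OF f A]]
      csubspace_vimage[OF g B csubspace_image[OF g csubspace_image[OF f A]]]
    unfolding N_def Kf_def Kg_def D_def by simp_all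
  have hA: "?h ` A = g ` f ` A" by (simp add: image_image)
  let ?I = "Kg \<inter> f ` A"
  have subI: "csubspace ?I" using sub complex_vector.subspace_inter by blast
  have "{x \<in> N. f x = 0} = Kf"
    using clinear_0[OF g] by (auto simp: N_def Kf_def)
  moreover have "f ` N = ?I"
    using fA by (auto simp: N_def Kg_def)
  ultimately have N: "finite_dim N \<longleftrightarrow> finite_dim Kf \<and> finite_dim ?I"
    "finite_dim N \<Longrightarrow> complex_vector.dim N = complex_vector.dim Kf + complex_vector.dim ?I"
    using rank_nullity[OF f sub(1)] by auto
  let ?q = "quotient_map (f ` A)"
  note q = clinear_quotient_map[OF sub(4)] quotient_map_eq_0_iff[OF sub(4)]
  have fAD: "f ` A \<subseteq> D" and DB: "D \<subseteq> B" using fA by (auto simp: D_def)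
  have "?q ` D = ?q ` Kg"
  proof
    show "?q ` Kg \<subseteq> ?q ` D"
      using sub(6) by (auto simp: Kg_def D_def complex_vector.subspace_0)
    show "?q ` D \<subseteq> ?q ` Kg"
    proof (rule image_subsetI)
      fix y assume y: "y \<in> D"
      then obtain x where x: "x \<in> A" "g y = g (f x)" by (auto simp: D_def)
      then have "y - f x \<in> Kg"
        using y fA B by (auto simp: Kg_def D_def clinear_diff[OF g] complex_vector.subspace_diff)
      moreover have "?q (y - f x) = ?q y"
        using q(2)[of "f x"] x(1) by (simp add: clinear_diff[OF q(1)])
      ultimately show "?q y \<in> ?q ` Kg" by (metis imageI)
    qed
  qed
  moreover have "{y \<in> Kg. ?q y = 0} = ?I" by (auto simp: q(2))
  ultimately have K: "finite_dim Kg \<longleftrightarrow> finite_dim ?I \<and> finite_quotient (f ` A) D"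
    "finite_dim Kg \<Longrightarrow> complex_vector.dim Kg = complex_vector.dim ?I + quotient_dim (f ` A) D"
    using rank_nullity[OF q(1) sub(3)] by (simp_all add: finite_quotient_def quotient_dim_def)
  let ?r = "quotient_map (g ` f ` A)"
  note r = clinear_quotient_map[OF sub(6)] quotient_map_eq_0_iff[OF sub(6)]
  have kD: "?r (g y) = 0 \<longleftrightarrow> y \<in> D" if "y \<in> B" for y
    using that by (simp add: r(2) D_def)
  have DBq: "finite_quotient D B \<longleftrightarrow> finite_quotient (g ` f ` A) (g ` B)"
    "quotient_dim D B = quotient_dim (g ` f ` A) (g ` B)"
    using quotient_by_kernel[OF clinear_compose[OF g r(1)] B sub(8) kD DB]
    by (simp_all add: finite_quotient_def quotient_dim_def image_image)
  have gfB: "g ` f ` A \<subseteq> g ` B" using fA by blast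
  note tower_fA = quotient_tower[OF sub(4,8) B fAD DB]
  note tower_gA = quotient_tower[OF sub(6,5) C gfB gB]
  have f_def: "fredholm f A B \<longleftrightarrow> finite_dim Kf \<and> finite_quotient (f ` A) B"
    "index f A B = int (complex_vector.dim Kf) - int (quotient_dim (f ` A) B)"
    using f A B fA by (simp_all add: fredholm_def index_def Kf_def)
  have g_def: "fredholm g B C \<longleftrightarrow> finite_dim Kg \<and> finite_quotient (g ` B) C"
    "index g B C = int (complex_vector.dim Kg) - int (quotient_dim (g ` B) C)"
    using g C B gB by (simp_all add: fredholm_def index_def Kg_def)
  have h_def: "fredholm ?h A C \<longleftrightarrow> finite_dim N \<and> finite_quotient (g ` f ` A) C"
    "index ?h A C = int (complex_vector.dim N) - int (quotient_dim (g ` f ` A) C)"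
    using h A C fA gB by (auto simp: fredholm_def index_def N_def hA)
  show 1: "fredholm g B C \<longleftrightarrow> fredholm ?h A C" if "fredholm f A B"
    using that N(1) K(1) DBq(1) tower_fA(1) tower_gA(1) unfolding f_def g_def h_def by blast
  show "index ?h A C = index f A B + index g B C" if "fredholm f A B" "fredholm g B C"
  proof -
    have "fredholm ?h A C" using 1 that by blast
    then show ?thesis
      using that N K DBq tower_fA tower_gA unfolding f_def g_def h_def by simp
  qed
qed

lemma fredholm_compose_iff:
  assumes "fredholm f A B" and "clinear g" "csubspace C" "g ` B \<subseteq> C"
  shows "fredholm (\<lambda>x. g (f x)) A C \<longleftrightarrow> fredholm g B C"
  using assms fredholm_compose_lemma(1)[of f g A B C] unfolding fredholm_def by blast

lemma index_compose:
  assumes "fredholm f A B" "fredholm g B C"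
  shows "index (\<lambda>x. g (f x)) A C = index f A B + index g B C"
  using assms fredholm_compose_lemma(2)[of f g A B C] unfolding fredholm_def by blast

text \<open>
  If \<open>g\<close> is bijective, then \<open>f\<close> is \<open>g f\<close> followed by the inverse of \<open>g\<close>.
\<close>

lemma fredholm_of_injective_compose:
  assumes f: "clinear f" "csubspace A" "f ` A \<subseteq> B"
    and g: "clinear g" "csubspace B" "inj_on g B" "g ` B = C"
    and gf: "fredholm (\<lambda>x. g (f x)) A C"
  shows "fredholm f A B"
proof -
  obtain k where k: "range k \<subseteq> B" "clinear k" "\<forall>x\<in>B. k (g x) = x"
    using clinear_left_inverse[OF g(1-3)] by auto
  have C: "csubspace C" using csubspace_image[OF g(1,2)] g(4) by simp
  have "inj_on k C" "k ` C = B" using g(4) k(3) by (auto simp: inj_on_def image_image)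
  from bijective_fredholm(1)[OF k(2) C this] have kf: "fredholm k C B" .
  have "fredholm (\<lambda>x. k (g (f x))) A B"
    using fredholm_compose_iff[OF gf k(2) g(2)] kf \<open>k ` C = B\<close> by simp
  moreover have "clinear (\<lambda>x. k (g (f x)))"
    using clinear_compose[OF clinear_compose[OF f(1) g(1)] k(2)] .
  ultimately show ?thesis
    using fredholm_cong[of "\<lambda>x. k (g (f x))" f A B] f k(3) by auto
qed


lemma inclusion_fredholm:
  assumes "csubspace A'" "csubspace A" "A' \<subseteq> A" "finite_quotient A' A"
  shows "fredholm (\<lambda>x. x) A' A"
proof -
  have "{x \<in> A'. x = 0} = {0}" using assms(1) by (auto simp: complex_vector.subspace_0)
  then show ?thesis using assms by (simp add: fredholm_def clinear_ident finite_dim_zero)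
qed

lemma finite_quotient_kernel:
  assumes "clinear f" "csubspace A" "finite_dim (f ` A)"
  shows "finite_quotient {x \<in> A. f x = 0} A"
  using quotient_by_kernel(1)[OF assms(1,2) csubspace_kernel[OF assms(1,2)]] assms(3) by auto

text \<open>
  The index of \<open>f\<close> on \<open>A\<close> and the index of its restriction to \<open>A'\<close> differ by the index of the
  inclusion of \<open>A'\<close> in \<open>A\<close>, which does not depend on \<open>f\<close>.
\<close>

lemma
  assumes A': "csubspace A'" "A' \<subseteq> A" "finite_quotient A' A"
    and f: "fredholm f A B" and g: "clinear g" "g ` A \<subseteq> B"
    and eq: "\<And>x. x \<in> A' \<Longrightarrow> f x = g x"
  shows fredholm_change_finite_codim: "fredholm g A B"
    and index_change_finite_codim: "index g A B = index f A B"
proof -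
  have A: "csubspace A" and B: "csubspace B" and lf: "clinear f" and fA: "f ` A \<subseteq> B"
    using f by (auto simp: fredholm_def)
  note i = inclusion_fredholm[OF A'(1) A A'(2,3)]
  have "fredholm f A' B"
    using fredholm_compose_iff[OF i lf B fA] f by simp
  then have "fredholm g A' B"
    using fredholm_cong[of f g A' B] lf g eq by blast
  then show gf: "fredholm g A B"
    using fredholm_compose_iff[OF i g(1) B g(2)] by simp
  have "index f A' B = index g A' B"
    using index_cong[of f g A' B] lf g eq by blast
  then show "index g A B = index f A B"
    using index_compose[OF i f] index_compose[OF i gf] by simp
qed

lemma csubspace_Times: "csubspace A \<Longrightarrow> csubspace B \<Longrightarrow> csubspace (A \<times> B)"
  by (rule complex_vector.subspaceI)
    (auto simp: scaleC_prod_def zero_prod_def complex_vector.subspace_0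
      complex_vector.subspace_add complex_vector.subspace_scale)

lemma clinear_fst: "clinear fst" and clinear_snd: "clinear snd"
  by (auto intro!: clinearI simp: scaleC_prod_def)

lemma clinear_plus: "clinear f \<Longrightarrow> clinear g \<Longrightarrow> clinear (\<lambda>x. f x + g x)"
  by (auto intro!: clinearI simp: clinear_add clinear_scaleC scaleC_add_right)

lemma clinear_map_prod: "clinear f \<Longrightarrow> clinear g \<Longrightarrow> clinear (map_prod f g)"
  by (auto intro!: clinearI simp: scaleC_prod_def clinear_add clinear_scaleC map_prod_def split_beta)

lemma dim_Times:
  assumes A: "csubspace A" and B: "csubspace B"
  shows "finite_dim (A \<times> B) \<longleftrightarrow> finite_dim A \<and> finite_dim B"
    and "finite_dim (A \<times> B) \<Longrightarrow> complex_vector.dim (A \<times> B) = complex_vector.dim A + complex_vector.dim B"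
proof -
  have 0: "0 \<in> A" "0 \<in> B" using A B by (auto simp: complex_vector.subspace_0)
  have K: "{x \<in> A \<times> B. fst x = 0} = Pair 0 ` B" using 0 by auto
  have "clinear (\<lambda>x::'b. (0::'a, x))" "inj_on (\<lambda>x::'b. (0::'a, x)) B"
    by (auto intro!: clinearI simp: scaleC_prod_def inj_on_def)
  note i = dim_inj_image[OF this(1) B this(2)]
  have "fst ` (A \<times> B) = A" using 0 by auto
  then show "finite_dim (A \<times> B) \<longleftrightarrow> finite_dim A \<and> finite_dim B"
    and "finite_dim (A \<times> B) \<Longrightarrow> complex_vector.dim (A \<times> B) = complex_vector.dim A + complex_vector.dim B"
    using rank_nullity[OF clinear_fst csubspace_Times[OF A B]] i unfolding K by auto
qed

lemma
  assumes f: "clinear f" "csubspace A" "csubspace B" "f ` A \<subseteq> B"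
    and g: "clinear g" "csubspace C" "csubspace D" "g ` C \<subseteq> D"
  shows fredholm_map_prod_iff: "fredholm (map_prod f g) (A \<times> C) (B \<times> D) \<longleftrightarrow> fredholm f A B \<and> fredholm g C D"
    and index_map_prod: "fredholm f A B \<Longrightarrow> fredholm g C D \<Longrightarrow>
      index (map_prod f g) (A \<times> C) (B \<times> D) = index f A B + index g C D"
proof -
  let ?h = "map_prod f g"
  note h = clinear_map_prod[OF f(1) g(1)]
  have im: "?h ` (A \<times> C) = f ` A \<times> g ` C" by (rule map_prod_surj_on) auto
  have ker: "{x \<in> A \<times> C. ?h x = 0} = {x \<in> A. f x = 0} \<times> {x \<in> C. g x = 0}"
    by (auto simp: zero_prod_def)
  note subs = csubspace_image[OF f(1,2)] csubspace_image[OF g(1,2)]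
  let ?p = "quotient_map (f ` A)" and ?q = "quotient_map (g ` C)"
  note p = clinear_quotient_map[OF subs(1)] quotient_map_eq_0_iff[OF subs(1)]
  note q = clinear_quotient_map[OF subs(2)] quotient_map_eq_0_iff[OF subs(2)]
  have im': "map_prod ?p ?q ` (B \<times> D) = ?p ` B \<times> ?q ` D" by (rule map_prod_surj_on) auto
  have Q: "finite_quotient (f ` A \<times> g ` C) (B \<times> D) \<longleftrightarrow> finite_dim (?p ` B \<times> ?q ` D)"
    "quotient_dim (f ` A \<times> g ` C) (B \<times> D) = complex_vector.dim (?p ` B \<times> ?q ` D)"
    using quotient_by_kernel[OF clinear_map_prod[OF p(1) q(1)] csubspace_Times[OF f(3) g(3)]
        csubspace_Times[OF subs] _ Sigma_mono[OF f(4) g(4)]]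
    by (auto simp: im' p(2) q(2) zero_prod_def)
  note dQ = dim_Times[OF csubspace_image[OF p(1) f(3)] csubspace_image[OF q(1) g(3)]]
  note dK = dim_Times[OF csubspace_kernel[OF f(1,2)] csubspace_kernel[OF g(1,2)]]
  have hAC: "?h ` (A \<times> C) \<subseteq> B \<times> D" using f(4) g(4) by auto
  show "fredholm ?h (A \<times> C) (B \<times> D) \<longleftrightarrow> fredholm f A B \<and> fredholm g C D"
    using f g h hAC csubspace_Times[OF f(2) g(2)] csubspace_Times[OF f(3) g(3)] Q dQ dK
    unfolding fredholm_def ker im finite_quotient_def by auto
  show "index ?h (A \<times> C) (B \<times> D) = index f A B + index g C D" if "fredholm f A B" "fredholm g C D"
    using that Q dQ dK unfolding fredholm_def index_def ker im finite_quotient_def quotient_dim_def by simp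
qed

section \<open>The addition map of a pair of subspaces\<close>

lemma add_map_kernel_image:
  assumes "csubspace V" "csubspace W"
  shows "{x \<in> V \<times> W. fst x + snd x = 0} = (\<lambda>x. (x, - x)) ` (V \<inter> W)"
    and "(\<lambda>x. fst x + snd x) ` (V \<times> W) = V + W"
proof -
  show "{x \<in> V \<times> W. fst x + snd x = 0} = (\<lambda>x. (x, - x)) ` (V \<inter> W)"
  proof (intro equalityI subsetI)
    fix x assume x: "x \<in> {x \<in> V \<times> W. fst x + snd x = 0}"
    then have "snd x = - fst x" by (simp add: eq_neg_iff_add_eq_0 add.commute)
    moreover from this have "fst x = - snd x" by simp
    then have "fst x \<in> W" using x assms by (auto simp: complex_vector.subspace_neg)
    ultimately show "x \<in> (\<lambda>x. (x, - x)) ` (V \<inter> W)"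
      using x by (intro image_eqI[of _ _ "fst x"]) (auto simp: prod_eq_iff)
  qed (use assms in \<open>auto simp: complex_vector.subspace_neg\<close>)
  show "(\<lambda>x. fst x + snd x) ` (V \<times> W) = V + W"
    by (force simp: set_plus_def)
qed

lemma clinear_add_map: "clinear (\<lambda>x. fst x + snd x)"
  by (rule clinear_plus[OF clinear_fst clinear_snd])

lemma add_map_kernel_dim:
  assumes "csubspace V" "csubspace W"
  shows "finite_dim {x \<in> V \<times> W. fst x + snd x = 0} \<longleftrightarrow> finite_dim (V \<inter> W)"
    and "complex_vector.dim {x \<in> V \<times> W. fst x + snd x = 0} = complex_vector.dim (V \<inter> W)"
proof -
  have "clinear (\<lambda>x::'a. (x, - x))"
    by (rule clinearI) (auto simp: scaleC_prod_def)
  from dim_inj_image[OF this complex_vector.subspace_inter[OF assms]]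
  show "finite_dim {x \<in> V \<times> W. fst x + snd x = 0} \<longleftrightarrow> finite_dim (V \<inter> W)"
    and "complex_vector.dim {x \<in> V \<times> W. fst x + snd x = 0} = complex_vector.dim (V \<inter> W)"
    by (auto simp: add_map_kernel_image(1)[OF assms] inj_on_def)
qed

lemma fredholm_add_map:
  assumes "fredholm_pair V W"
  shows "fredholm (\<lambda>x. fst x + snd x) (V \<times> W) UNIV"
  using assms add_map_kernel_dim[of V W] add_map_kernel_image[of V W] codim_eq_quotient_dim(1)[of "V + W"]
    csubspace_image[OF clinear_add_map csubspace_Times, of V W]
  unfolding fredholm_pair_def closed_csubspace_def fredholm_def
  by (simp add: csubspace_Times clinear_add_map)

lemma finite_codim_of_finite_quotient:
  assumes V: "csubspace V" and "finite_quotient V UNIV"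
  shows "finite_codim V"
proof -
  let ?q = "quotient_map V"
  note q = clinear_quotient_map[OF V] quotient_map_idem[OF V] quotient_map_eq_0_iff[OF V]
  obtain B where B: "finite B" "range ?q \<subseteq> complex_vector.span B"
    using assms(2) by (auto simp: finite_quotient_def finite_dim_def)
  have "x \<in> complex_vector.span (V \<union> B)" for x
  proof -
    have "x - ?q x \<in> V" by (simp add: q(3)[symmetric] clinear_diff[OF q(1)] q(2))
    then have "x - ?q x \<in> complex_vector.span (V \<union> B)" by (simp add: complex_vector.span_base)
    moreover have "?q x \<in> complex_vector.span (V \<union> B)"
      using B(2) complex_vector.span_mono[of B "V \<union> B"] by auto
    ultimately have "(x - ?q x) + ?q x \<in> complex_vector.span (V \<union> B)"
      by (rule complex_vector.span_add)
    then show ?thesis by simp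
  qed
  then show ?thesis using B(1) unfolding finite_codim_def by blast
qed

lemma pair_index_eq_index:
  assumes "csubspace V" "csubspace W" and "fredholm (\<lambda>x. fst x + snd x) (V \<times> W) UNIV"
  shows "pair_index V W = index (\<lambda>x. fst x + snd x) (V \<times> W) UNIV"
proof -
  have "csubspace (V + W)"
    using csubspace_image[OF clinear_add_map csubspace_Times] assms(1,2) add_map_kernel_image(2) by metis
  then show ?thesis
    using assms add_map_kernel_dim[OF assms(1,2)] add_map_kernel_image[OF assms(1,2)]
      codim_eq_quotient_dim(2)[of "V + W"] finite_codim_of_finite_quotient[of "V + W"]
    by (simp add: pair_index_def index_def fredholm_def)
qed



section \<open>Orthogonal projections of finite rank\<close>

lemma cinner_0_left: "cinner 0 y = 0"
  using cinner_add_left[of 0 0 y] by simp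

lemma cinner_diff_left: "cinner (x - y) z = cinner x z - cinner y z"
  using cinner_add_left[of "x - y" y z] by simp

lemma cinner_add_right: "cinner x (y + z) = cinner x y + cinner x z"
  using cinner_commute[of x "y + z"] cinner_commute[of x y] cinner_commute[of x z]
  by (simp add: cinner_add_left)

lemma cinner_scaleC_right: "cinner x (c *\<^sub>C y) = cnj c * cinner x y"
  using cinner_commute[of x "c *\<^sub>C y"] cinner_commute[of x y]
  by (simp add: cinner_scaleC_left)

lemma cinner_zero_commute: "cinner x y = 0 \<longleftrightarrow> cinner y x = 0"
  using cinner_commute[of x y] cinner_commute[of y x] by auto

lemma cinner_self_eq_0_iff: "cinner x x = 0 \<longleftrightarrow> x = 0"
proof
  assume "cinner x x = 0"
  then have "inner x x = 0" by (simp add: Re_cinner[symmetric])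
  then show "x = 0" by simp
qed (simp add: cinner_0_left)

lemma csubspace_imp_subspace: "csubspace V \<Longrightarrow> subspace V"
  unfolding subspace_def
  by (metis complex_vector.subspace_0 complex_vector.subspace_add complex_vector.subspace_scale scaleC_of_real)

lemma clinear_imp_linear: "clinear f \<Longrightarrow> linear f"
  by (rule linearI) (simp_all add: clinear_add, metis clinear_scaleC scaleC_of_real)

lemma bounded_clinear_iff: "bounded_clinear f \<longleftrightarrow> clinear f \<and> bounded_linear f"
  unfolding bounded_clinear_def clinear_iff using linear_add[OF bounded_linear.linear] by blast

lemma pythagoras:
  fixes x y :: "'a::chilbert_space"
  assumes "cinner x y = 0"
  shows "norm y \<le> norm (x + y)" and "norm x \<le> norm (x + y)"
proof -
  have "inner x y = 0" using assms by (simp add: Re_cinner[symmetric])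
  then have "(norm (x + y))\<^sup>2 = (norm x)\<^sup>2 + (norm y)\<^sup>2"
    by (simp add: power2_norm_eq_inner inner_add_left inner_add_right inner_commute)
  then have "(norm y)\<^sup>2 \<le> (norm (x + y))\<^sup>2" "(norm x)\<^sup>2 \<le> (norm (x + y))\<^sup>2" by simp_all
  then show "norm y \<le> norm (x + y)" and "norm x \<le> norm (x + y)"
    by (simp_all add: power2_le_iff_abs_le)
qed

text \<open>One step of the Gram-Schmidt process for each element of \<open>B\<close>.\<close>

lemma orthogonal_projection_span:
  assumes "finite B"
  shows "\<exists>E. clinear E \<and> range E \<subseteq> complex_vector.span B \<and>
    (\<forall>x. \<forall>y\<in>complex_vector.span B. cinner (x - E x) y = 0)"
  using assms
proof (induction B)
  case empty
  show ?case
    by (rule exI[of _ "\<lambda>x. 0"]) (auto intro!: clinearI simp: cinner_zero_commute[of _ 0] cinner_0_left)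
next
  case (insert b B)
  then obtain E where E: "clinear E" "range E \<subseteq> complex_vector.span B"
    and orth: "\<And>x y. y \<in> complex_vector.span B \<Longrightarrow> cinner (x - E x) y = 0" by blast
  define b' where "b' = b - E b"
  define E' where "E' x = E x + (cinner x b' / cinner b' b') *\<^sub>C b'" for x
  have E'_lin: "clinear E'"
    unfolding E'_def
    by (rule clinearI)
      (simp_all add: clinear_add[OF E(1)] clinear_scaleC[OF E(1)] cinner_add_left cinner_scaleC_left
        add_divide_distrib scaleC_add_left scaleC_add_right scaleC_scaleC)
  have EB: "E x \<in> complex_vector.span B" for x using E(2) by auto
  have sub: "complex_vector.span B \<subseteq> complex_vector.span (insert b B)"
    by (rule complex_vector.span_mono) auto
  have b'_in: "b' \<in> complex_vector.span (insert b B)"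
    unfolding b'_def using EB sub complex_vector.span_base[of b "insert b B"]
    by (intro complex_vector.span_diff) auto
  have range: "range E' \<subseteq> complex_vector.span (insert b B)"
    unfolding E'_def using EB sub b'_in
    by (auto intro!: complex_vector.span_add complex_vector.span_scale)
  have b'B: "cinner b' y = 0" if "y \<in> complex_vector.span B" for y
    unfolding b'_def using orth[OF that] .
  have o1: "cinner (x - E' x) y = 0" if "y \<in> complex_vector.span B" for x y
    using orth[OF that, of x] b'B[OF that] unfolding E'_def
    by (simp add: diff_diff_eq[symmetric] cinner_diff_left cinner_scaleC_left)
  have o2: "cinner (x - E' x) b' = 0" for x
  proof (cases "b' = 0")
    case True
    then show ?thesis by (simp add: cinner_zero_commute[of _ 0] cinner_0_left)
  next
    case False
    have "cinner (E x) b' = 0" using b'B[OF EB[of x]] cinner_zero_commute by blast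
    then show ?thesis
      using False unfolding E'_def
      by (simp add: diff_diff_eq[symmetric] cinner_diff_left cinner_scaleC_left cinner_self_eq_0_iff)
  qed
  have "cinner (x - E' x) y = 0" if y: "y \<in> complex_vector.span (insert b B)" for x y
  proof -
    obtain k where k: "y - k *\<^sub>C b \<in> complex_vector.span B"
      using y complex_vector.span_breakdown_eq[of y b B] by blast
    have "y = (y - k *\<^sub>C b + k *\<^sub>C E b) + k *\<^sub>C b'"
      by (simp add: b'_def complex_vector.scale_right_diff_distrib)
    moreover have "y - k *\<^sub>C b + k *\<^sub>C E b \<in> complex_vector.span B"
      using k EB by (intro complex_vector.span_add complex_vector.span_scale)
    ultimately show ?thesis
      using o1 o2 by (metis add.right_neutral cinner_add_right cinner_scaleC_right mult_zero_right)
  qed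
  with E'_lin range show ?case by blast
qed

lemma orthogonal_projection_exists:
  fixes V :: "'a::chilbert_space set"
  assumes "finite_dim V" "csubspace V"
  obtains E where "bounded_clinear E" "range E \<subseteq> V" "\<And>x. x \<in> V \<Longrightarrow> E x = x"
    "\<And>x y. y \<in> V \<Longrightarrow> norm (x - E x) \<le> norm (x - y)"
proof -
  obtain B where B: "finite B" "complex_vector.span B = V"
    using finite_dim_basis[OF assms] by metis
  obtain E where E: "clinear E" "range E \<subseteq> V" "\<And>x y. y \<in> V \<Longrightarrow> cinner (x - E x) y = 0"
    using orthogonal_projection_span[OF B(1)] unfolding B(2) by blast
  have EV: "E x \<in> V" for x using E(2) by auto
  have "norm (E x) \<le> norm x" for x
    using pythagoras(1)[OF E(3)[OF EV[of x], of x]] by simp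
  then have "bounded_linear E"
    using clinear_imp_linear[OF E(1)]
    by (intro bounded_linear_intro[where K = 1]) (auto simp: linear_add linear_scale)
  then have 1: "bounded_clinear E" using E(1) by (simp add: bounded_clinear_iff)
  have 2: "E x = x" if "x \<in> V" for x
  proof -
    have "x - E x \<in> V" using that EV assms(2) by (simp add: complex_vector.subspace_diff)
    from E(3)[OF this, of x] show ?thesis by (simp add: cinner_self_eq_0_iff)
  qed
  have 3: "norm (x - E x) \<le> norm (x - y)" if "y \<in> V" for x y
  proof -
    have "E x - y \<in> V" using that EV assms(2) by (simp add: complex_vector.subspace_diff)
    from pythagoras(2)[OF E(3)[OF this, of x]] show ?thesis by simp
  qed
  show ?thesis using that[OF 1 E(2) 2 3] .
qed

lemma finite_dim_closed:
  fixes V :: "'a::chilbert_space set"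
  assumes "finite_dim V" "csubspace V" shows "closed V"
proof -
  obtain E where E: "bounded_clinear E" "range E \<subseteq> V" "\<And>x. x \<in> V \<Longrightarrow> E x = x"
    by (rule orthogonal_projection_exists[OF assms]) blast
  have "V = {x. E x = x}" using E(2,3) by (auto, metis rangeI subsetD)
  moreover have "continuous_on UNIV E"
    using E(1) by (simp add: bounded_clinear_iff linear_continuous_on)
  ultimately show ?thesis
    using closed_Collect_eq[of E "\<lambda>x. x"] by auto
qed

section \<open>Compact operators\<close>

text \<open>
  The image of the unit ball has a finite \<open>\<epsilon>/2\<close>-net, and \<open>F\<close> is \<open>K\<close> followed by the orthogonal
  projection to the span of the net. The projection moves a point no farther than the nearest point
  of the net does, so \<open>K\<close> and \<open>F\<close> are close on the unit ball.
\<close>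

lemma compact_operator_approx:
  assumes K: "compact_operator K" and "\<epsilon> > 0"
  obtains F where "clinear F" "finite_dim (range F)" "\<And>x. norm (K x - F x) \<le> \<epsilon> * norm x"
proof -
  have Klin: "clinear K" and comp: "compact (closure (K ` ball 0 1))"
    using K by (auto simp: compact_operator_def bounded_clinear_iff)
  from comp have "\<forall>e>0. \<exists>k. finite k \<and> k \<subseteq> closure (K ` ball 0 1) \<and> closure (K ` ball 0 1) \<subseteq> (\<Union>x\<in>k. ball x e)"
    by (simp add: compact_imp_seq_compact seq_compact_imp_totally_bounded)
  then obtain k where k: "finite k" "closure (K ` ball 0 1) \<subseteq> (\<Union>x\<in>k. ball x (\<epsilon> / 2))"
    using \<open>\<epsilon> > 0\<close> by (meson half_gt_zero)
  have fd: "finite_dim (complex_vector.span k)" using k(1) by (auto simp: finite_dim_def)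
  obtain E where E: "bounded_clinear E" "range E \<subseteq> complex_vector.span k"
    "\<And>x y. y \<in> complex_vector.span k \<Longrightarrow> norm (x - E x) \<le> norm (x - y)"
    by (rule orthogonal_projection_exists[OF fd complex_vector.subspace_span]) blast
  have Elin: "clinear E" using E(1) by (simp add: bounded_clinear_iff)
  let ?F = "\<lambda>x. E (K x)"
  note Flin = clinear_compose[OF Klin Elin]
  have D: "linear (\<lambda>x. K x - ?F x)"
    using clinear_imp_linear[OF Klin] clinear_imp_linear[OF Flin] by (rule linear_compose_sub)
  have ball: "norm (K x - ?F x) \<le> \<epsilon> / 2" if x: "norm x < 1" for x
  proof -
    have "K x \<in> closure (K ` ball 0 1)" using x closure_subset[of "K ` ball 0 1"] by auto
    then obtain y where y: "y \<in> k" "dist y (K x) < \<epsilon> / 2" using k(2) by auto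
    have "norm (K x - ?F x) \<le> norm (K x - y)"
      using y(1) by (intro E(3) complex_vector.span_base)
    with y(2) show ?thesis by (simp add: dist_norm norm_minus_commute)
  qed
  have "norm (K x - ?F x) \<le> \<epsilon> * norm x" for x
  proof (cases "x = 0")
    case True
    then show ?thesis using linear_0[OF D] by simp
  next
    case False
    let ?c = "1 / (2 * norm x)"
    have "norm (K (?c *\<^sub>R x) - ?F (?c *\<^sub>R x)) \<le> \<epsilon> / 2"
      using False by (intro ball) simp
    then have "?c * norm (K x - ?F x) \<le> \<epsilon> / 2"
      using linear_scale[OF D, of ?c x] norm_scaleR[of ?c "K x - ?F x"] by simp
    then show ?thesis using False by (simp add: field_simps)
  qed
  moreover have "finite_dim (range ?F)"
    using fd E(2) by (rule_tac finite_dim_subset) auto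
  ultimately show ?thesis using that Flin by blast
qed


section \<open>The bounded inverse theorem\<close>

text \<open>
  By Baire's theorem the closure \<open>S n\<close> of the image of some ball of \<open>Z\<close> has an interior point; it is
  convex and symmetric, so it contains a ball around \<open>0\<close>. Hence every \<open>y\<close> is the image of
  some \<open>z\<close> with \<open>norm z \<le> c * norm y\<close> up to an error of \<open>norm y / 2\<close>. Iterating on the error gives a
  series that converges in \<open>Z\<close> to an exact preimage, of norm at most \<open>2 * c * norm y\<close>.
\<close>

lemma bounded_below_of_bijective:
  fixes T :: "'a::banach \<Rightarrow> 'b::banach"
  assumes T: "bounded_linear T" and Z: "subspace Z" "closed Z"
    and inj: "\<And>z. z \<in> Z \<Longrightarrow> T z = 0 \<Longrightarrow> z = 0" and surj: "T ` Z = UNIV"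
  obtains M where "M > 0" "\<And>z. z \<in> Z \<Longrightarrow> norm z \<le> M * norm (T z)"
proof -
  have lin: "linear T" using T by (rule bounded_linear.linear)
  define S where "S n = closure (T ` (Z \<inter> cball 0 (real n)))" for n
  have US: "\<Union>(range S) = UNIV"
  proof -
    have "y \<in> \<Union>(range S)" for y
    proof -
      obtain z where z: "z \<in> Z" "y = T z" using surj by blast
      obtain n where "norm z \<le> real n" using real_arch_simple[of "norm z"] ..
      with z have "y \<in> T ` (Z \<inter> cball 0 (real n))" by simp
      then have "y \<in> S n" unfolding S_def by (rule subsetD[OF closure_subset])
      then show ?thesis by blast
    qed
    then show ?thesis by blast
  qed
  have "\<exists>n. interior (S n) \<noteq> {}"
  proof (rule ccontr)
    assume "\<not> ?thesis"
    then have empty: "interior (S n) = {}" for n by blast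
    have "Met_TC.mtopology interior_of \<Union>(range S) = {}"
    proof (rule Met_TC.metric_Baire_category_alt)
      show "Met_TC.mcomplete TYPE('b)" by (simp add: complete_UNIV)
      show "countable (range S)" by simp
      fix X assume "X \<in> range S"
      then show "closedin Met_TC.mtopology X \<and> Met_TC.mtopology interior_of X = {}"
        using empty by (elim rangeE) (simp add: S_def)
    qed
    then have "interior (\<Union>(range S)) = {}" by simp
    then show False by (simp add: US)
  qed
  then obtain n y0 where "y0 \<in> interior (S n)" by blast
  then obtain r where r: "r > 0" "ball y0 r \<subseteq> S n" by (auto simp: mem_interior)
  have conv: "convex (S n)"
    unfolding S_def
    by (rule convex_closure[OF convex_linear_image[OF lin
          convex_Int[OF subspace_imp_convex[OF Z(1)] convex_cball]]])
  have neg: "- y \<in> S n" if y: "y \<in> S n" for y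
  proof -
    obtain f where f: "\<And>k. f k \<in> T ` (Z \<inter> cball 0 (real n))" "f \<longlonglongrightarrow> y"
      using y unfolding S_def closure_sequential by blast
    have "- f k \<in> T ` (Z \<inter> cball 0 (real n))" for k
    proof -
      obtain z where z: "z \<in> Z" "z \<in> cball 0 (real n)" "f k = T z" using f(1)[of k] by blast
      then have "- z \<in> Z \<inter> cball 0 (real n)" using Z(1) by (simp add: subspace_neg)
      then have "T (- z) \<in> T ` (Z \<inter> cball 0 (real n))" by (rule imageI)
      then show ?thesis by (simp add: z(3) linear_neg[OF lin])
    qed
    with tendsto_minus[OF f(2)] show ?thesis
      unfolding S_def closure_sequential by (intro exI[of _ "\<lambda>k. - f k"]) blast
  qed
  have ball0: "v \<in> S n" if v: "norm v < r" for v
  proof -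
    have "y0 + v \<in> S n" "y0 - v \<in> S n" using v r(2) by (auto simp: dist_norm)
    then have "(1/2) *\<^sub>R (y0 + v) + (1/2) *\<^sub>R (- (y0 - v)) \<in> S n"
      using convexD[OF conv _ neg, of "y0 + v" "y0 - v" "1/2" "1/2"] by simp
    moreover have "(1/2) *\<^sub>R (y0 + v) + (1/2) *\<^sub>R (- (y0 - v)) = v"
      by (simp add: scaleR_add_right scaleR_diff_right flip: scaleR_add_left)
    ultimately show ?thesis by simp
  qed
  define c where "c = 2 * real n / r"
  have "\<exists>z\<in>Z. norm z \<le> c * norm y \<and> norm (y - T z) \<le> norm y / 2" for y
  proof (cases "y = 0")
    case True
    then show ?thesis using Z(1) lin by (intro bexI[of _ 0]) (auto simp: subspace_0 linear_0)
  next
    case False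
    let ?s = "2 * norm y / r"
    have s: "?s > 0" using False r by simp
    have "norm ((1 / ?s) *\<^sub>R y) < r" using False r by simp
    then have *: "(1 / ?s) *\<^sub>R y \<in> closure (T ` (Z \<inter> cball 0 (real n)))"
      using ball0 unfolding S_def by blast
    obtain w where w: "w \<in> Z" "norm w \<le> real n" "dist (T w) ((1 / ?s) *\<^sub>R y) < r / 4"
    proof -
      have "r / 4 > 0" using r(1) by simp
      then obtain x where "x \<in> T ` (Z \<inter> cball 0 (real n))" "dist x ((1 / ?s) *\<^sub>R y) < r / 4"
        using * unfolding closure_approachable by blast
      then show ?thesis using that by auto
    qed
    have "y - T (?s *\<^sub>R w) = ?s *\<^sub>R ((1 / ?s) *\<^sub>R y - T w)"
      using s False r by (simp add: linear_scale[OF lin] scaleR_diff_right)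
    then have "norm (y - T (?s *\<^sub>R w)) = ?s * norm ((1 / ?s) *\<^sub>R y - T w)"
      using s by (metis abs_of_pos norm_scaleR)
    also have "\<dots> \<le> ?s * (r / 4)"
      using s w(3) by (intro mult_left_mono) (auto simp: dist_norm norm_minus_commute)
    also have "\<dots> = norm y / 2" using r by simp
    finally have "norm (y - T (?s *\<^sub>R w)) \<le> norm y / 2" .
    moreover have "norm (?s *\<^sub>R w) \<le> c * norm y"
    proof -
      have "norm (?s *\<^sub>R w) = ?s * norm w" using s by (metis abs_of_pos norm_scaleR)
      also have "\<dots> \<le> ?s * real n" using s w(2) by (intro mult_left_mono) auto
      finally show ?thesis by (simp add: c_def mult_ac)
    qed
    ultimately show ?thesis using w(1) Z(1) by (intro bexI[of _ "?s *\<^sub>R w"]) (auto simp: subspace_scale)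
  qed
  then obtain g where g: "\<And>y. g y \<in> Z" "\<And>y. norm (g y) \<le> c * norm y"
    "\<And>y. norm (y - T (g y)) \<le> norm y / 2" by metis
  have c0: "c \<ge> 0" using r by (simp add: c_def)
  have bound: "norm z \<le> (2 * c + 1) * norm (T z)" if z: "z \<in> Z" for z
  proof -
    define Y where "Y k = ((\<lambda>y. y - T (g y)) ^^ k) (T z)" for k
    have Y0: "Y 0 = T z" and YS: "Y (Suc k) = Y k - T (g (Y k))" for k by (simp_all add: Y_def)
    have nY: "norm (Y k) \<le> norm (T z) * (1 / 2) ^ k" for k
    proof (induction k)
      case (Suc k)
      have "norm (Y (Suc k)) \<le> norm (Y k) / 2" unfolding YS by (rule g(3))
      with Suc show ?case by simp
    qed (simp add: Y0)
    have ng: "norm (g (Y k)) \<le> (c * norm (T z)) * (1 / 2) ^ k" for k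
      using g(2)[of "Y k"] mult_left_mono[OF nY[of k] c0] by simp
    have geo: "summable (\<lambda>k. (c * norm (T z)) * (1 / 2) ^ k)"
      by (intro summable_mult summable_geometric) simp
    have sumg: "summable (\<lambda>k. norm (g (Y k)))"
      by (rule summable_comparison_test'[OF geo, of 0]) (simp add: ng)
    define x where "x = (\<Sum>k. g (Y k))"
    have lim: "(\<lambda>m. \<Sum>k<m. g (Y k)) \<longlonglongrightarrow> x"
      unfolding x_def using summable_norm_cancel[OF sumg] by (rule summable_LIMSEQ)
    have xZ: "x \<in> Z"
      using Z(2) _ lim by (rule closed_sequentially) (simp add: g(1) subspace_sum[OF Z(1)])
    have "T (\<Sum>k<m. g (Y k)) = T z - Y m" for m
      by (induction m) (simp_all add: Y0 YS linear_0[OF lin] linear_add[OF lin])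
    moreover have "Y \<longlonglongrightarrow> 0"
    proof (rule Lim_null_comparison)
      show "\<forall>\<^sub>F k in sequentially. norm (Y k) \<le> norm (T z) * (1 / 2) ^ k" using nY by simp
      show "(\<lambda>k. norm (T z) * (1 / 2) ^ k) \<longlonglongrightarrow> 0"
        by (intro tendsto_mult_right_zero LIMSEQ_realpow_zero) auto
    qed
    then have "(\<lambda>m. T z - Y m) \<longlonglongrightarrow> T z - 0" by (intro tendsto_intros)
    moreover have "(\<lambda>m. T (\<Sum>k<m. g (Y k))) \<longlonglongrightarrow> T x"
      using bounded_linear.tendsto[OF T lim] .
    ultimately have "T x = T z" using LIMSEQ_unique by fastforce
    then have "x = z"
      using inj[of "x - z"] xZ z Z(1) by (simp add: linear_diff[OF lin] subspace_diff)
    have "norm x \<le> (\<Sum>k. norm (g (Y k)))" unfolding x_def using sumg by (rule summable_norm)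
    also have "\<dots> \<le> (\<Sum>k. (c * norm (T z)) * (1 / 2) ^ k)" by (rule suminf_le[OF ng sumg geo])
    also have "\<dots> = (c * norm (T z)) * 2"
      by (subst suminf_mult) (auto simp: suminf_geometric)
    also have "\<dots> \<le> (2 * c + 1) * norm (T z)" by (simp add: algebra_simps)
    finally show ?thesis using \<open>x = z\<close> by simp
  qed
  \<comment> \<open>Here \<open>c\<close> may vanish (if \<open>n = 0\<close>), so \<open>1\<close> is added to make the constant positive.\<close>
  show ?thesis using that[of "2 * c + 1"] bound c0 by auto
qed



section \<open>Stability of the index\<close>

lemma closed_csubspace_Times:
  "closed_csubspace V \<Longrightarrow> closed_csubspace W \<Longrightarrow> closed_csubspace (V \<times> W)"
  by (simp add: closed_csubspace_def csubspace_Times closed_Times)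

lemma bounded_clinear_add_map: "bounded_clinear (\<lambda>x. fst x + snd x)"
  by (simp add: bounded_clinear_iff clinear_add_map bounded_linear_add bounded_linear_fst bounded_linear_snd)

text \<open>
  Cut the kernel off the domain (\<open>A1\<close>) and add a complement \<open>C\<close> of the range: then
  \<open>T (x, c) = f x + c\<close> is a bijection of \<open>A1 \<times> C\<close> onto the whole space, bounded below by
  the bounded inverse theorem. A perturbation that is small against this bound keeps it bijective, by
  Banach's fixed point theorem. So \<open>f\<close> and \<open>f + k\<close> both arise on \<open>A1\<close> from the same embedding
  \<open>A1 \<rightarrow> A1 \<times> C\<close> followed by a bijection, and their indices agree on \<open>A1\<close>; hence also on \<open>A\<close>.
\<close>

lemma index_small_perturbation:
  fixes f :: "'a::chilbert_space \<Rightarrow> 'b::chilbert_space"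
  assumes f: "bounded_clinear f" and A: "closed_csubspace A" and fred: "fredholm f A UNIV"
  obtains \<epsilon> where "\<epsilon> > 0"
    "\<And>k. clinear k \<Longrightarrow> (\<And>x. norm (k x) \<le> \<epsilon> * norm x) \<Longrightarrow>
       fredholm (\<lambda>x. f x + k x) A UNIV \<and> index (\<lambda>x. f x + k x) A UNIV = index f A UNIV"
proof -
  have lf: "clinear f" and bf: "bounded_linear f" using f by (auto simp: bounded_clinear_iff)
  have sA: "csubspace A" and cA: "closed A" using A by (auto simp: closed_csubspace_def)
  define N where "N = {x \<in> A. f x = 0}"
  have N: "finite_dim N" "csubspace N"
    using fred csubspace_kernel[OF lf sA] by (auto simp: fredholm_def N_def)
  obtain E where E: "bounded_clinear E" "range E \<subseteq> N" "\<And>x. x \<in> N \<Longrightarrow> E x = x"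
    by (rule orthogonal_projection_exists[OF N]) blast
  have lE: "clinear E" and bE: "bounded_linear E" using E(1) by (auto simp: bounded_clinear_iff)
  define A1 where "A1 = {x \<in> A. E x = 0}"
  have A1: "csubspace A1" "A1 \<subseteq> A"
    using csubspace_kernel[OF lE sA] by (auto simp: A1_def)
  have "A1 = A \<inter> {x. E x = 0}" by (auto simp: A1_def)
  then have cA1: "closed A1"
    using cA bE by (auto intro!: closed_Int closed_Collect_eq simp: linear_continuous_on)
  have "finite_dim (E ` A)" using N(1) E(2) by (rule_tac finite_dim_subset) auto
  then have fin: "finite_quotient A1 A"
    unfolding A1_def by (rule finite_quotient_kernel[OF lE sA])
  note incl = inclusion_fredholm[OF A1(1) sA A1(2) fin]
  have sfA: "csubspace (f ` A)" by (rule csubspace_image[OF lf sA])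
  let ?q = "quotient_map (f ` A)"
  note q = clinear_quotient_map[OF sfA] quotient_map_idem[OF sfA] quotient_map_eq_0_iff[OF sfA]
  define C where "C = range ?q"
  have C: "finite_dim C" "csubspace C"
    using fred csubspace_image[OF q(1), of UNIV] by (auto simp: C_def fredholm_def finite_quotient_def)
  have qC: "?q c = c" if "c \<in> C" for c using that q(2) by (auto simp: C_def)
  define Z where "Z = A1 \<times> C"
  have sZ: "csubspace Z" and cZ: "closed Z"
    using A1 C cA1 finite_dim_closed[OF C] by (auto simp: Z_def csubspace_Times closed_Times)
  let ?T = "\<lambda>z. f (fst z) + snd z"
  have lT: "clinear ?T"
    by (rule clinear_plus[OF clinear_compose[OF clinear_fst lf] clinear_snd])
  have bT: "bounded_linear ?T"
    by (intro bounded_linear_add bounded_linear_snd bounded_linear_compose[OF bf bounded_linear_fst])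
  have inj: "z = 0" if "z \<in> Z" "?T z = 0" for z
  proof -
    have z: "fst z \<in> A" "E (fst z) = 0" "snd z \<in> C" using that by (auto simp: Z_def A1_def)
    have "?q (?T z) = snd z"
      using z q(3)[of "f (fst z)"] by (simp add: clinear_add[OF q(1)] qC)
    then have "snd z = 0" using that clinear_0[OF q(1)] by simp
    then have "fst z \<in> N" using z that by (simp add: N_def)
    then have "fst z = 0" using E(3) z by force
    with \<open>snd z = 0\<close> show ?thesis by (simp add: prod_eq_iff)
  qed
  have "\<exists>z\<in>Z. ?T z = y" for y
  proof -
    have "y - ?q y \<in> f ` A" by (simp add: q(3)[symmetric] clinear_diff[OF q(1)] q(2))
    then obtain a where a: "a \<in> A" "f a = y - ?q y" by (metis imageE)
    have EN: "E a \<in> N" using E(2) by auto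
    then have "a - E a \<in> A1" "f (a - E a) = f a"
      using a sA E(3)[OF EN] by (auto simp: A1_def N_def complex_vector.subspace_diff clinear_diff[OF lE] clinear_diff[OF lf])
    then show ?thesis using a by (intro bexI[of _ "(a - E a, ?q y)"]) (auto simp: Z_def C_def)
  qed
  then have "\<forall>y. \<exists>z. z \<in> Z \<and> ?T z = y" by blast
  then obtain h where "\<forall>y. h y \<in> Z \<and> ?T (h y) = y" unfolding choice_iff ..
  then have h: "\<And>y. h y \<in> Z" "\<And>y. ?T (h y) = y" by blast+
  have "y \<in> ?T ` Z" for y
    by (rule image_eqI[where x = "h y"]) (simp_all only: h)
  then have surj: "?T ` Z = UNIV" by blast
  obtain M where M: "M > 0" "\<And>z. z \<in> Z \<Longrightarrow> norm z \<le> M * norm (?T z)"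
    using bounded_below_of_bijective[OF bT csubspace_imp_subspace[OF sZ] cZ inj surj] by blast
  have injT: "inj_on ?T Z" using inj by (simp add: clinear_inj_on_iff[OF lT sZ])
  note T = bijective_fredholm[OF lT sZ injT surj]
  let ?j = "\<lambda>x::'a. (x, 0::'b)"
  have lj: "clinear ?j" by (rule clinearI) (auto simp: scaleC_prod_def)
  have jZ: "?j ` A1 \<subseteq> Z" using C by (auto simp: Z_def complex_vector.subspace_0)
  have "fredholm f A1 UNIV" using fredholm_compose_iff[OF incl lf] fred by simp
  then have j: "fredholm ?j A1 Z"
    using fredholm_of_injective_compose[OF lj A1(1) jZ lT sZ injT surj] by simp
  show ?thesis
  proof (rule that[of "1 / (2 * M)"])
    show "1 / (2 * M) > 0" using M(1) by simp
    fix k :: "'a \<Rightarrow> 'b" assume lk: "clinear k" and k: "\<And>x. norm (k x) \<le> 1 / (2 * M) * norm x"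
    let ?g = "\<lambda>x. f x + k x"
    let ?T' = "\<lambda>z. ?g (fst z) + snd z"
    have lg: "clinear ?g" using clinear_plus[OF lf lk] .
    have lT': "clinear ?T'"
      by (rule clinear_plus[OF clinear_compose[OF clinear_fst lg] clinear_snd])
    have kz: "norm (k (fst z)) \<le> norm (?T z) / 2" if "z \<in> Z" for z
    proof -
      have nf: "norm (fst z) \<le> norm z" using norm_fst_le[of "fst z" "snd z"] by simp
      have "norm (k (fst z)) \<le> 1 / (2 * M) * norm (fst z)" by (rule k)
      also have "\<dots> \<le> 1 / (2 * M) * (M * norm (?T z))"
        using order_trans[OF nf M(2)[OF that]] M(1) by (intro mult_left_mono) auto
      also have "\<dots> = norm (?T z) / 2" using M(1) by simp
      finally show ?thesis .
    qed
    have T'eq: "?T' z = ?T z + k (fst z)" for z by simp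
    have "z = 0" if "z \<in> Z" "?T' z = 0" for z
    proof -
      have "?T z = - k (fst z)" using that(2) unfolding T'eq by (simp only: eq_neg_iff_add_eq_0)
      then have "norm (?T z) \<le> norm (?T z) / 2" using kz[OF that(1)] by (metis norm_minus_cancel)
      then have "?T z = 0" by simp
      then show ?thesis using inj that(1) by blast
    qed
    then have injT': "inj_on ?T' Z" by (simp add: clinear_inj_on_iff[OF lT' sZ])
    have "y \<in> ?T' ` Z" for y
    proof -
      \<comment> \<open>With \<open>h\<close> the inverse of \<open>T\<close>, a fixed point \<open>u\<close> of this contraction gives the preimage \<open>h u\<close>.\<close>
      let ?\<phi> = "\<lambda>u. y - k (fst (h u))"
      have "dist (?\<phi> u) (?\<phi> v) \<le> 1 / 2 * dist u v" for u v
      proof -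
        have hZ: "h u - h v \<in> Z" using h(1) sZ by (simp add: complex_vector.subspace_diff)
        have "?\<phi> u - ?\<phi> v = - k (fst (h u - h v))" by (simp add: clinear_diff[OF lk])
        then have "norm (?\<phi> u - ?\<phi> v) = norm (k (fst (h u - h v)))" by (metis norm_minus_cancel)
        also have "\<dots> \<le> norm (?T (h u - h v)) / 2" by (rule kz[OF hZ])
        also have "?T (h u - h v) = u - v" unfolding clinear_diff[OF lT] h(2) ..
        finally show ?thesis by (simp add: dist_norm)
      qed
      then obtain u where "?\<phi> u = u" using banach_fix_type[of "1/2" ?\<phi>] by auto
      then have "u + k (fst (h u)) = y" by (simp add: algebra_simps)
      then have "?T' (h u) = y" unfolding T'eq h(2) .
      then show ?thesis using h(1) by (rule image_eqI[OF sym])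
    qed
    then have surj': "?T' ` Z = UNIV" by blast
    note T' = bijective_fredholm[OF lT' sZ injT' surj']
    have gA1: "fredholm ?g A1 UNIV" "index ?g A1 UNIV = index f A1 UNIV"
      using fredholm_compose_iff[OF j lT'] T'(1) index_compose[OF j T'(1)] index_compose[OF j T(1)] T T'
      by simp_all
    have g: "fredholm ?g A UNIV" using fredholm_compose_iff[OF incl lg] gA1 by simp
    then show "fredholm ?g A UNIV \<and> index ?g A UNIV = index f A UNIV"
      using index_compose[OF incl g] index_compose[OF incl fred] gA1 by simp
  qed
qed

text \<open>
  Write \<open>K = (K - F) + F\<close> with \<open>K - F\<close> small and \<open>F\<close> of finite rank. The first summand is handled by
  \<open>index_small_perturbation\<close>; the second vanishes on a subspace of finite codimension.
\<close>

lemma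
  fixes f :: "'a::chilbert_space \<Rightarrow> 'b::chilbert_space"
  assumes f: "bounded_clinear f" and A: "closed_csubspace A" and fred: "fredholm f A UNIV"
    and K: "compact_operator K"
  shows fredholm_compact_perturbation: "fredholm (\<lambda>x. f x + K x) A UNIV"
    and index_compact_perturbation: "index (\<lambda>x. f x + K x) A UNIV = index f A UNIV"
proof -
  have lf: "clinear f" and lK: "clinear K"
    using f K by (auto simp: bounded_clinear_iff compact_operator_def)
  have sA: "csubspace A" using A by (simp add: closed_csubspace_def)
  obtain \<epsilon> where \<epsilon>: "\<epsilon> > 0"
    "\<And>k. clinear k \<Longrightarrow> (\<And>x. norm (k x) \<le> \<epsilon> * norm x) \<Longrightarrow>
       fredholm (\<lambda>x. f x + k x) A UNIV \<and> index (\<lambda>x. f x + k x) A UNIV = index f A UNIV"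
    using index_small_perturbation[OF f A fred] by blast
  obtain F where F: "clinear F" "finite_dim (range F)" "\<And>x. norm (K x - F x) \<le> \<epsilon> * norm x"
    using compact_operator_approx[OF K \<epsilon>(1)] by blast
  have lk: "clinear (\<lambda>x. K x - F x)"
    by (rule clinearI) (simp_all add: clinear_add[OF lK] clinear_add[OF F(1)] clinear_scaleC[OF lK]
      clinear_scaleC[OF F(1)] complex_vector.scale_right_diff_distrib)
  let ?g = "\<lambda>x. f x + (K x - F x)"
  have g: "fredholm ?g A UNIV" "index ?g A UNIV = index f A UNIV"
    using \<epsilon>(2)[OF lk F(3)] by auto
  let ?A' = "{x \<in> A. F x = 0}"
  have "finite_dim (F ` A)" using F(2) by (rule finite_dim_subset) auto
  note fin = finite_quotient_kernel[OF F(1) sA this]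
  have A': "csubspace ?A'" "?A' \<subseteq> A" using csubspace_kernel[OF F(1) sA] by auto
  have eq: "?g x = f x + K x" if "x \<in> ?A'" for x using that by simp
  show "fredholm (\<lambda>x. f x + K x) A UNIV"
    using fredholm_change_finite_codim[OF A' fin g(1) clinear_plus[OF lf lK] _ eq] by simp
  show "index (\<lambda>x. f x + K x) A UNIV = index f A UNIV"
    using index_change_finite_codim[OF A' fin g(1) clinear_plus[OF lf lK] _ eq] g(2) by simp
qed

section \<open>Operations on compact operators\<close>

lemma compact_operatorI:
  assumes "bounded_clinear K" "K ` ball 0 1 \<subseteq> C" "compact C"
  shows "compact_operator K"
proof -
  have "closure (K ` ball 0 1) \<subseteq> C"
    using assms(2,3) by (simp add: closure_minimal compact_imp_closed)
  then have "closure (K ` ball 0 1) = C \<inter> closure (K ` ball 0 1)" by blast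
  then show ?thesis
    using assms(1) compact_Int_closed[OF assms(3) closed_closure] unfolding compact_operator_def by metis
qed

lemma bounded_clinear_compose:
  "bounded_clinear f \<Longrightarrow> bounded_clinear g \<Longrightarrow> bounded_clinear (\<lambda>x. g (f x))"
  by (simp add: bounded_clinear_iff clinear_compose bounded_linear_compose)

lemma compact_operator_compose:
  fixes R :: "'a::chilbert_space \<Rightarrow> 'b::chilbert_space" and K :: "'b \<Rightarrow> 'c::chilbert_space"
    and J :: "'c \<Rightarrow> 'd::chilbert_space"
  assumes K: "compact_operator K" and J: "bounded_clinear J"
    and R: "bounded_clinear R" "\<And>x. norm (R x) \<le> norm x"
  shows "compact_operator (\<lambda>x. J (K (R x)))"
proof (rule compact_operatorI)
  show "bounded_clinear (\<lambda>x. J (K (R x)))"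
    using K J R by (auto simp: compact_operator_def intro: bounded_clinear_compose)
  show "(\<lambda>x. J (K (R x))) ` ball 0 1 \<subseteq> J ` closure (K ` ball 0 1)"
  proof (rule image_subsetI)
    fix x :: 'a assume "x \<in> ball 0 1"
    then have "R x \<in> ball 0 1" using le_less_trans[OF R(2)] by simp
    then have "K (R x) \<in> closure (K ` ball 0 1)"
      by (intro subsetD[OF closure_subset] imageI)
    then show "J (K (R x)) \<in> J ` closure (K ` ball 0 1)" by (rule imageI)
  qed
  show "compact (J ` closure (K ` ball 0 1))"
    using K J by (intro compact_continuous_image linear_continuous_on)
      (auto simp: compact_operator_def bounded_clinear_iff)
qed

lemma compact_operator_add:
  assumes K: "compact_operator K" and L: "compact_operator L"
  shows "compact_operator (\<lambda>x. K x + L x)"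
proof (rule compact_operatorI)
  let ?C = "{x + y |x y. x \<in> closure (K ` ball 0 1) \<and> y \<in> closure (L ` ball 0 1)}"
  show "bounded_clinear (\<lambda>x. K x + L x)"
    using K L by (simp add: compact_operator_def bounded_clinear_iff clinear_plus bounded_linear_add)
  show "(\<lambda>x. K x + L x) ` ball 0 1 \<subseteq> ?C"
    using closure_subset[of "K ` ball 0 1"] closure_subset[of "L ` ball 0 1"] by blast
  show "compact ?C"
    using K L by (intro compact_sums) (auto simp: compact_operator_def)
qed

lemma compact_operator_diff:
  fixes K L :: "'a::chilbert_space \<Rightarrow> 'b::chilbert_space"
  assumes K: "compact_operator K" and L: "compact_operator L"
  shows "compact_operator (\<lambda>x. K x - L x)"
proof -
  have u: "bounded_clinear (uminus :: 'b \<Rightarrow> 'b)" and i: "bounded_clinear (\<lambda>x::'a. x)"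
    by (auto simp: bounded_clinear_iff clinear_ident bounded_linear_ident bounded_linear_minus intro!: clinearI)
  show ?thesis
    using compact_operator_add[OF K compact_operator_compose[OF L u i]] by simp
qed

section \<open>Splittings\<close>

lemma splitting_bounded:
  assumes "S \<in> splittings \<rho>"
  shows "bounded_clinear (flat_proj S)" "bounded_clinear (sharp_proj S)"
  using assms by (auto simp: splittings_def projector_def)

lemma splitting_proj:
  assumes "S \<in> splittings \<rho>"
  shows "flat_proj S x + sharp_proj S x = x"
    and "flat_proj S (flat_proj S x) = flat_proj S x"
    and "sharp_proj S (sharp_proj S x) = sharp_proj S x"
    and "flat_proj S (sharp_proj S x) = 0"
    and "sharp_proj S (flat_proj S x) = 0"
proof -
  show 1: "flat_proj S x + sharp_proj S x = x" for x
    using assms by (auto simp: splittings_def)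
  show 2: "flat_proj S (flat_proj S x) = flat_proj S x" "sharp_proj S (sharp_proj S x) = sharp_proj S x" for x
    using assms by (auto simp: splittings_def projector_def fun_eq_iff)
  show "flat_proj S (sharp_proj S x) = 0" "sharp_proj S (flat_proj S x) = 0"
    using 1[of "sharp_proj S x"] 1[of "flat_proj S x"] 2[of x] by auto
qed

lemma
  assumes "S \<in> splittings \<rho>"
  shows flat_iff: "x \<in> flat S \<longleftrightarrow> flat_proj S x = x"
    and sharp_iff: "x \<in> sharp S \<longleftrightarrow> sharp_proj S x = x"
  using splitting_proj(2,3)[OF assms] unfolding flat_def sharp_def by (auto, metis rangeI, metis rangeI)

lemma closed_csubspace_range:
  assumes "bounded_clinear P" "\<And>x. P (P x) = P x"
  shows "closed_csubspace (range P)"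
proof -
  have "range P = {x. P x = x}" using assms(2) by (auto, metis rangeI)
  then have "closed (range P)"
    using assms(1) closed_Collect_eq[of P "\<lambda>x. x"] by (simp add: bounded_clinear_iff linear_continuous_on)
  then show ?thesis
    using csubspace_image[of P UNIV] assms(1) by (simp add: closed_csubspace_def bounded_clinear_iff)
qed

lemma
  assumes "S \<in> splittings \<rho>"
  shows closed_flat: "closed_csubspace (flat S)" and closed_sharp: "closed_csubspace (sharp S)"
  unfolding flat_def sharp_def
  using closed_csubspace_range splitting_bounded[OF assms] splitting_proj(2,3)[OF assms] by blast+

lemma splitting_sum_bijective:
  assumes S: "S \<in> splittings \<rho>"
  shows "inj_on (\<lambda>x. fst x + snd x) (flat S \<times> sharp S)"
    and "(\<lambda>x. fst x + snd x) ` (flat S \<times> sharp S) = UNIV"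
proof -
  have sub: "csubspace (flat S \<times> sharp S)"
    using closed_flat[OF S] closed_sharp[OF S] by (simp add: closed_csubspace_def csubspace_Times)
  have lin: "clinear (flat_proj S)" using splitting_bounded(1)[OF S] by (simp add: bounded_clinear_iff)
  show "inj_on (\<lambda>x. fst x + snd x) (flat S \<times> sharp S)"
    unfolding clinear_inj_on_iff[OF clinear_add_map sub]
  proof (intro ballI impI)
    fix x assume x: "x \<in> flat S \<times> sharp S" "fst x + snd x = 0"
    then have "flat_proj S (fst x) = fst x" "flat_proj S (snd x) = 0"
      using splitting_proj(4)[OF S] by (auto simp: flat_iff[OF S] sharp_def)
    moreover have "flat_proj S (fst x + snd x) = 0" using x clinear_0[OF lin] by simp
    ultimately have "fst x = 0" by (simp add: clinear_add[OF lin])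
    with x show "x = 0" by (simp add: prod_eq_iff)
  qed
  have "y \<in> (\<lambda>x. fst x + snd x) ` (flat S \<times> sharp S)" for y
    using splitting_proj(1)[OF S, of y]
    by (intro image_eqI[of _ _ "(flat_proj S y, sharp_proj S y)"]) (auto simp: flat_def sharp_def)
  then show "(\<lambda>x. fst x + snd x) ` (flat S \<times> sharp S) = UNIV" by blast
qed

lemma polarization_members:
  fixes H :: "('a::cstar_algebra, 'b::chilbert_space) polarized_rep"
  assumes "polarized_representation H" "S \<in> polarization H" "T \<in> polarization H"
  shows "S \<in> splittings (rep H)"
    and "compact_operator (\<lambda>x. flat_proj S x - flat_proj T x)"
    and "compact_operator (\<lambda>x. sharp_proj S x - sharp_proj T x)"
proof -
  obtain R where "polarization H = splitting_equiv (rep H) `` {R}"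
    using assms(1) unfolding polarized_representation_def by (auto elim: quotientE)
  with assms(2,3) have R: "(R, S) \<in> splitting_equiv (rep H)" "(R, T) \<in> splitting_equiv (rep H)" by auto
  then show "S \<in> splittings (rep H)" by (auto simp: splitting_equiv_def)
  have *: "compact_operator (\<lambda>x. p x - q x)"
    if "compact_operator (\<lambda>x. r x - p x)" "compact_operator (\<lambda>x. r x - q x)" for p q r :: "'b \<Rightarrow> 'b"
    using compact_operator_diff[OF that(2,1)] by simp
  show "compact_operator (\<lambda>x. flat_proj S x - flat_proj T x)"
    "compact_operator (\<lambda>x. sharp_proj S x - sharp_proj T x)"
    using R by (auto intro: * simp: splitting_equiv_def)
qed

text \<open>
  The relative index of the summands \<open>T\<^sup>\<flat>\<close> and \<open>S\<^sup>\<flat>\<close>, compared by the projector of \<open>S\<close>. It vanishes if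
  \<open>S = T\<close>, and it depends on the splittings only: this is what makes the changes of index cancel.
\<close>

definition flat_index :: "'h::chilbert_space splitting \<Rightarrow> 'h splitting \<Rightarrow> int" where
  "flat_index S T = index (flat_proj S) (flat T) (flat S)"

text \<open>
  On \<open>T\<^sup>\<flat> \<times> T\<^sup>\<sharp>\<close> the map \<open>(x, y) \<mapsto> P\<^sub>S\<^sup>\<flat> x + P\<^sub>S\<^sup>\<sharp> y\<close> is a compact perturbation of \<open>(x, y) \<mapsto> x + y\<close>, which is a
  bijection onto the whole space, so it is Fredholm of index \<open>0\<close>. It is also the product of the two
  projectors followed by the bijection \<open>S\<^sup>\<flat> \<times> S\<^sup>\<sharp> \<rightarrow> H\<close>, so that product is Fredholm of index \<open>0\<close>, and the
  index of a product is the sum of the indices.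
\<close>

lemma
  fixes H :: "('a::cstar_algebra, 'b::chilbert_space) polarized_rep"
  assumes H: "polarized_representation H" and S: "S \<in> polarization H" and T: "T \<in> polarization H"
  shows fredholm_flat: "fredholm (flat_proj S) (flat T) (flat S)"
    and fredholm_sharp: "fredholm (sharp_proj S) (sharp T) (sharp S)"
    and index_sharp: "index (sharp_proj S) (sharp T) (sharp S) = - flat_index S T"
proof -
  note S' = polarization_members(1)[OF H S S] and T' = polarization_members(1)[OF H T T]
  note K = polarization_members(2,3)[OF H S T]
  note sub = closed_flat[OF S'] closed_sharp[OF S'] closed_flat[OF T'] closed_sharp[OF T']
  note csub = sub[unfolded closed_csubspace_def, THEN conjunct1]
  let ?add = "\<lambda>x::'b \<times> 'b. fst x + snd x"
  let ?g = "map_prod (flat_proj S) (sharp_proj S)"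
  let ?K = "\<lambda>x. (flat_proj S (fst x) - flat_proj T (fst x)) + (sharp_proj S (snd x) - sharp_proj T (snd x))"
  have lin: "clinear (flat_proj S)" "clinear (sharp_proj S)"
    using splitting_bounded[OF S'] by (auto simp: bounded_clinear_iff)
  have i: "bounded_clinear (\<lambda>x::'b. x)" and bf: "bounded_clinear (fst :: 'b \<times> 'b \<Rightarrow> 'b)"
    and bs: "bounded_clinear (snd :: 'b \<times> 'b \<Rightarrow> 'b)"
    by (auto simp: bounded_clinear_iff clinear_ident clinear_fst clinear_snd bounded_linear_ident
      bounded_linear_fst bounded_linear_snd)
  have cK: "compact_operator ?K"
    by (intro compact_operator_add compact_operator_compose[OF K(1) i bf]
      compact_operator_compose[OF K(2) i bs]) (metis norm_fst_le norm_snd_le prod.collapse)+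
  note bijT = bijective_fredholm[OF clinear_add_map csubspace_Times[OF csub(3,4)] splitting_sum_bijective[OF T']]
  note bijS = bijective_fredholm[OF clinear_add_map csubspace_Times[OF csub(1,2)] splitting_sum_bijective[OF S']]
  note P = fredholm_compact_perturbation[OF bounded_clinear_add_map closed_csubspace_Times[OF sub(3,4)] bijT(1) cK]
    index_compact_perturbation[OF bounded_clinear_add_map closed_csubspace_Times[OF sub(3,4)] bijT(1) cK]
  have eq: "?add x + ?K x = ?add (?g x)" if "x \<in> flat T \<times> sharp T" for x
    using that flat_iff[OF T', of "fst x"] sharp_iff[OF T', of "snd x"] by auto
  have l1: "clinear (\<lambda>x. ?add x + ?K x)"
    using cK by (intro clinear_plus[OF clinear_add_map]) (simp add: compact_operator_def bounded_clinear_iff)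
  note lg = clinear_map_prod[OF lin]
  note l2 = clinear_compose[OF lg clinear_add_map]
  have comp: "fredholm (\<lambda>x. ?add (?g x)) (flat T \<times> sharp T) UNIV"
    "index (\<lambda>x. ?add (?g x)) (flat T \<times> sharp T) UNIV = 0"
    using fredholm_cong[OF l1 l2 eq] index_cong[OF l1 l2 eq] P bijT(2) by auto
  have im: "flat_proj S ` flat T \<subseteq> flat S" "sharp_proj S ` sharp T \<subseteq> sharp S"
    by (auto simp: flat_def sharp_def)
  have img: "?g ` (flat T \<times> sharp T) \<subseteq> flat S \<times> sharp S" using im by auto
  have g: "fredholm ?g (flat T \<times> sharp T) (flat S \<times> sharp S)"
    by (rule fredholm_of_injective_compose[OF lg csubspace_Times[OF csub(3,4)] img clinear_add_map
        csubspace_Times[OF csub(1,2)] splitting_sum_bijective[OF S'] comp(1)])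
  note prods = lin(1) csub(3,1) im(1) lin(2) csub(4,2) im(2)
  show 1: "fredholm (flat_proj S) (flat T) (flat S)" and 2: "fredholm (sharp_proj S) (sharp T) (sharp S)"
    using g fredholm_map_prod_iff[OF prods] by auto
  show "index (sharp_proj S) (sharp T) (sharp S) = - flat_index S T"
    using index_compose[OF g bijS(1)] comp(2) bijS(2) index_map_prod[OF prods 1 2] by (simp add: flat_index_def)
qed

section \<open>Change of splittings\<close>

text \<open>
  On \<open>L \<times> W\<^sub>T\<close> with \<open>W\<^sub>T = T\<^sub>1\<^sup>\<flat> \<times> T\<^sub>2\<^sup>\<sharp>\<close>, the projectors of \<open>S\<^sub>1\<close> and \<open>S\<^sub>2\<close> followed by addition differ from
  addition by the compact operator \<open>K\<close>, because the projectors of \<open>T\<^sub>1\<close> and \<open>T\<^sub>2\<close> fix the elements of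
  \<open>W\<^sub>T\<close>. Comparing indices along the composite \<open>L \<times> W\<^sub>T \<rightarrow> L \<times> W\<^sub>S \<rightarrow> H\<close> gives both claims.
\<close>

lemma
  fixes H1 :: "('b1::cstar_algebra, 'a::chilbert_space) polarized_rep"
    and H2 :: "('b2::cstar_algebra, 'c::chilbert_space) polarized_rep"
  assumes H1: "polarized_representation H1" "S1 \<in> polarization H1" "T1 \<in> polarization H1"
    and H2: "polarized_representation H2" "S2 \<in> polarization H2" "T2 \<in> polarization H2"
    and L: "closed_csubspace L"
    and fred: "fredholm (\<lambda>x. fst x + snd x) (L \<times> (flat T1 \<times> sharp T2)) UNIV"
  shows fredholm_change_splitting:
      "fredholm (\<lambda>x. fst x + snd x) (L \<times> (flat S1 \<times> sharp S2)) UNIV"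
    and morphism_index_change_splitting:
      "morphism_index T1 T2 L = morphism_index S1 S2 L + flat_index S1 T1 - flat_index S2 T2"
proof -
  note S1 = polarization_members(1)[OF H1(1,2,2)] and T1 = polarization_members(1)[OF H1(1,3,3)]
  note S2 = polarization_members(1)[OF H2(1,2,2)] and T2 = polarization_members(1)[OF H2(1,3,3)]
  note K1 = polarization_members(2)[OF H1] and K2 = polarization_members(3)[OF H2]
  let ?WS = "flat S1 \<times> sharp S2" and ?WT = "flat T1 \<times> sharp T2"
  note fl = fredholm_flat[OF H1] and sh = fredholm_sharp[OF H2]
  let ?add = "\<lambda>x::('a \<times> 'c) \<times> 'a \<times> 'c. fst x + snd x"
  let ?w = "map_prod (flat_proj S1) (sharp_proj S2)"
  let ?g = "map_prod (\<lambda>x::'a \<times> 'c. x) ?w"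
  have sL: "csubspace L" using L by (simp add: closed_csubspace_def)
  note cl = closed_flat[OF S1] closed_sharp[OF S2] closed_flat[OF T1] closed_sharp[OF T2]
  note cW = closed_csubspace_Times[OF cl(1,2)] closed_csubspace_Times[OF cl(3,4)]
  note sW = cW[unfolded closed_csubspace_def, THEN conjunct1]
  have p1: "clinear (flat_proj S1)" "csubspace (flat T1)" "csubspace (flat S1)" "flat_proj S1 ` flat T1 \<subseteq> flat S1"
    using fl by (auto simp: fredholm_def)
  have p2: "clinear (sharp_proj S2)" "csubspace (sharp T2)" "csubspace (sharp S2)" "sharp_proj S2 ` sharp T2 \<subseteq> sharp S2"
    using sh by (auto simp: fredholm_def)
  have w: "fredholm ?w ?WT ?WS" "index ?w ?WT ?WS = flat_index S1 T1 - flat_index S2 T2"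
    using fredholm_map_prod_iff[OF p1 p2] index_map_prod[OF p1 p2 fl sh] fl sh index_sharp[OF H2]
    by (simp_all add: flat_index_def)
  have idL: "fredholm (\<lambda>x. x) L L" "index (\<lambda>x. x) L L = 0"
    by (rule bijective_fredholm[OF clinear_ident sL]; simp)+
  have wW: "?w ` ?WT \<subseteq> ?WS" using w(1) by (simp add: fredholm_def)
  have lw: "clinear ?w" by (rule clinear_map_prod[OF p1(1) p2(1)])
  have LL: "(\<lambda>x. x) ` L \<subseteq> L" by simp
  have g: "fredholm ?g (L \<times> ?WT) (L \<times> ?WS)"
    "index ?g (L \<times> ?WT) (L \<times> ?WS) = flat_index S1 T1 - flat_index S2 T2"
    using fredholm_map_prod_iff[OF clinear_ident sL sL LL lw sW(2,1) wW]
      index_map_prod[OF clinear_ident sL sL LL lw sW(2,1) wW idL(1) w(1)] idL w by auto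
  let ?K = "\<lambda>x::('a \<times> 'c) \<times> 'a \<times> 'c.
    (flat_proj S1 (fst (snd x)) - flat_proj T1 (fst (snd x)), 0)
    + (0, sharp_proj S2 (snd (snd x)) - sharp_proj T2 (snd (snd x)))"
  have J: "bounded_clinear (\<lambda>x::'a. (x, 0::'c))" "bounded_clinear (\<lambda>x::'c. (0::'a, x))"
    by (simp_all add: bounded_clinear_iff clinear_iff scaleC_prod_def bounded_linear_Pair
      bounded_linear_ident bounded_linear_zero)
  have R: "bounded_clinear (\<lambda>x::('a \<times> 'c) \<times> 'a \<times> 'c. fst (snd x))"
    "bounded_clinear (\<lambda>x::('a \<times> 'c) \<times> 'a \<times> 'c. snd (snd x))"
    by (simp_all add: bounded_clinear_iff clinear_compose[OF clinear_snd clinear_fst]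
      clinear_compose[OF clinear_snd clinear_snd] bounded_linear_compose[OF bounded_linear_fst bounded_linear_snd]
      bounded_linear_compose[OF bounded_linear_snd bounded_linear_snd])
  have nR: "norm (fst (snd x)) \<le> norm x" "norm (snd (snd x)) \<le> norm x" for x :: "('a \<times> 'c) \<times> 'a \<times> 'c"
    using norm_snd_le[of "snd x" "fst x"] norm_fst_le[of "fst (snd x)" "snd (snd x)"]
      norm_snd_le[of "snd (snd x)" "fst (snd x)"] by simp_all
  have cK: "compact_operator ?K"
    by (rule compact_operator_add[OF compact_operator_compose[OF K1 J(1) R(1) nR(1)]
          compact_operator_compose[OF K2 J(2) R(2) nR(2)]])
  have cA: "closed_csubspace (L \<times> ?WT)" by (rule closed_csubspace_Times[OF L cW(2)])
  note P = fredholm_compact_perturbation[OF bounded_clinear_add_map cA fred cK]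
    index_compact_perturbation[OF bounded_clinear_add_map cA fred cK]
  have eq: "?add x + ?K x = ?add (?g x)" if "x \<in> L \<times> ?WT" for x
    using that flat_iff[OF T1, of "fst (snd x)"] sharp_iff[OF T2, of "snd (snd x)"]
    by (auto simp: prod_eq_iff)
  have l1: "clinear (\<lambda>x. ?add x + ?K x)"
    using cK by (intro clinear_plus[OF clinear_add_map]) (simp add: compact_operator_def bounded_clinear_iff)
  have l2: "clinear (\<lambda>x. ?add (?g x))"
    by (rule clinear_compose[OF clinear_map_prod[OF clinear_ident lw] clinear_add_map])
  have comp: "fredholm (\<lambda>x. ?add (?g x)) (L \<times> ?WT) UNIV"
    "index (\<lambda>x. ?add (?g x)) (L \<times> ?WT) UNIV = index ?add (L \<times> ?WT) UNIV"
    using fredholm_cong[OF l1 l2 eq] index_cong[OF l1 l2 eq] P by auto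
  show S: "fredholm ?add (L \<times> ?WS) UNIV"
    using fredholm_compose_iff[OF g(1) clinear_add_map] comp(1) by simp
  show "morphism_index T1 T2 L = morphism_index S1 S2 L + flat_index S1 T1 - flat_index S2 T2"
    using index_compose[OF g(1) S] comp(2) g(2) pair_index_eq_index[OF sL sW(1) S]
      pair_index_eq_index[OF sL sW(2) fred] by (simp add: morphism_index_def)
qed

text \<open>
  A morphism is Fredholm for one pair \<open>R\<^sub>1, R\<^sub>2\<close> of splittings by definition; to compare \<open>S\<close> with \<open>T\<close>,
  the Fredholm property is first carried over from \<open>R\<close> to \<open>T\<close>.
\<close>

lemma morphism_index_difference:
  assumes H1: "polarized_representation H1" "S1 \<in> polarization H1" "T1 \<in> polarization H1"
    and H2: "polarized_representation H2" "S2 \<in> polarization H2" "T2 \<in> polarization H2"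
    and L: "morphism H1 H2 L"
  shows "morphism_index T1 T2 L = morphism_index S1 S2 L + flat_index S1 T1 - flat_index S2 T2"
proof -
  obtain R1 R2 where R: "R1 \<in> polarization H1" "R2 \<in> polarization H2" "fredholm_pair L (flat R1 \<times> sharp R2)"
    and cL: "closed_csubspace L"
    using L by (auto simp: morphism_def)
  have "fredholm (\<lambda>x. fst x + snd x) (L \<times> (flat T1 \<times> sharp T2)) UNIV"
    by (rule fredholm_change_splitting[OF H1(1,3) R(1) H2(1,3) R(2) cL fredholm_add_map[OF R(3)]])
  then show ?thesis by (rule morphism_index_change_splitting[OF H1 H2 cL])
qed

theorem theorem10p2:
  fixes H0 :: "('b0::cstar_algebra, 'h0::chilbert_space) polarized_rep"
    and H1 :: "('b1::cstar_algebra, 'h1::chilbert_space) polarized_rep"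
    and H2 :: "('b2::cstar_algebra, 'h2::chilbert_space) polarized_rep"
    and L1 :: "('h0 \<times> 'h1) set" and L2 :: "('h1 \<times> 'h2) set"
  assumes "polarized_representation H0" and "polarized_representation H1"
    and "polarized_representation H2"
    and "morphism H0 H1 L1" and "morphism H1 H2 L2"
    and "morphism H0 H2 (composition L2 L1)"
    and "S0 \<in> polarization H0" and "S1 \<in> polarization H1" and "S2 \<in> polarization H2"
    and "T0 \<in> polarization H0" and "T1 \<in> polarization H1" and "T2 \<in> polarization H2"
  shows "index_defect S0 S1 S2 L1 L2 = index_defect T0 T1 T2 L1 L2"
  using morphism_index_difference[OF assms(1,7,10) assms(2,8,11) assms(4)]
    morphism_index_difference[OF assms(2,8,11) assms(3,9,12) assms(5)]
    morphism_index_difference[OF assms(1,7,10) assms(3,9,12) assms(6)]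
  by (simp add: index_defect_def)

end
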